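(* Let $f(q)=\sum_{m=0}^n q^m a_m$ be a non-constant slice-regular polynomial whose twistor transform $G_f$ is planar, let $S_f=\mathrm{span}_{\mathbb R}\{a_1,\dots,a_n\}\subset\mathbb H$, $r=\dim_{\mathbb R}S_f$ (so $r\le3$), and $$\mathcal A_f=\{\Lambda\in\mathrm{Hom}_{\mathbb R}(\mathbb H,\mathbb C):\Lambda|_{S_f}=0\}.$$ The hyperplane sections containing $G_f$ are parametrized by $\mathbb P(\mathcal A_f)\cong\mathbb{CP}^{3-r}$. More precisely, for any $0\ne\Lambda\in\mathcal A_f$ one has $G_f(V)\subset X_{z_{\Lambda,f}}$, and every hyperplane section containing $G_f$ is obtained in this way, with $\Lambda$ determined up to multiplication by a non-zero complex scalar. Moreover, for a non-zero $\Lambda\in\mathcal A_f$, the hyperplane section $X_{z_{\Lambda,f}}$ has the following type: (i) if $\mathrm{rank}_{\mathbb R}\Lambda=1$, then $[z_{\Lambda,f}]\in A_-$, so $f$ is $A_-$-planar; (ii) if $\mathrm{rank}_{\mathbb R}\Lambda=2$ and $\Delta(\Lambda)=0$, then $[z_{\Lambda,f}]\in A_{Q\smallsetminus N}$, so $f$ is $A_{Q\smallsetminus N}$-planar; (iii) if $\mathrm{rank}_{\mathbb R}\Lambda=2$ and $\Delta(\Lambda)\ne0$, then $[z_{\Lambda,f}]\in A_{\mathrm{nd}}$, so $f$ is $A_{\mathrm{nd}}$-planar.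
   Context: $\mathbb H$ denotes the quaternions and $\mathbb S=\{q\in\mathbb H: q^2=-1\}$. Fix $i,j\in\mathbb S$ with $ij=-ji$, and put $\mathbb C:=\mathbb R+\mathbb R i\subset\mathbb H$, $\mathbb C^+:=\{x+yi:y>0\}$. Every quaternion is uniquely $z+wj$ with $z,w\in\mathbb C$. Let $\Omega\subset\mathbb H$ be a symmetric slice domain: a domain with $\Omega\cap\mathbb R\ne\emptyset$, with $\Omega\cap(\mathbb R+\mathbb R I)$ a domain for all $I\in\mathbb S$, and such that $x+yI\in\Omega$ implies $x+yI'\in\Omega$ for all $I,I'\in\mathbb S$. Put $V:=\Omega\cap\mathbb C^+$. Polynomials $\sum q^ma_m$ ($a_m\in\mathbb H$) are regarded as slice-regular functions on $\Omega$. Write $f(z)=g(z)+h(z)j$ for $z\in\Omega\cap\mathbb C$, with $g,h$ holomorphic and $\mathbb C$-valued, and $\hat g(z)=\overline{g(\overline z)}$, $\hat h(z)=\overline{h(\overline z)}$. The twistor transform of $f$ is the holomorphic curve $G_f:V\to\mathrm{Gr}_2(\mathbb C^4)\subset\mathbb P(\Lambda^2\mathbb C^4)\cong\mathbb{CP}^5$, $$G_f(v)=[g(v)\hat g(v)+h(v)\hat h(v):h(v):-g(v):\hat g(v):\hat h(v):1],$$ in homogeneous coordinates $[\zeta_1:\dots:\zeta_6]$ with respect to the basis $e_3\wedge e_4,\,-e_2\wedge e_4,\,e_2\wedge e_3,\,e_1\wedge e_4,\,-e_1\wedge e_3,\,e_1\wedge e_2$; here $\mathrm{Gr}_2(\mathbb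 C^4)$ is the quadric $\zeta_1\zeta_6-\zeta_2\zeta_5+\zeta_3\zeta_4=0$. For $0\neq z\in\mathbb C^6$ the hyperplane section is $X_z:=\mathrm{Gr}_2(\mathbb C^4)\cap\{[\zeta]:\sum_k z_k\zeta_k=0\}$, and $G_f$ is planar if $G_f(V)\subset X_z$ for some $z\ne0$. For $A\subset(\mathbb{CP}^5)^\vee$, $f$ is called $A$-planar if $G_f(V)\subset X_z$ for some $[z]\in A$. Each $\mathbb R$-linear $\Lambda:\mathbb H\to\mathbb C$ is uniquely of the form $\Lambda(b+cj)=z_2c-z_3b+z_4\overline b+z_5\overline c$ ($b,c\in\mathbb C$) with $z_2,\dots,z_5\in\mathbb C$. Put $\Delta(\Lambda):=z_3z_4-z_2z_5$, $\mathrm{rank}_{\mathbb R}\Lambda:=\dim_{\mathbb R}\Lambda(\mathbb H)$, and $z_{\Lambda,f}:=(0,z_2,z_3,z_4,z_5,-\Lambda(a_0))$. Types: let $\mathrm{GL}(2,\mathbb H)\subset\mathrm{GL}(4,\mathbb C)$ be the group of invertible block matrices whose four $2\times2$ blocks have the form $\begin{pmatrix} z & -\overline w \\ w & \overline z \end{pmatrix}$, $G=\mathrm{PGL}(2,\mathbb H)=\mathrm{GL}(2,\mathbb H)/\mathbb R^\times$, acting on $\mathbb P(\Lambda^2\mathbb C^4)$ via $T\cdot[u\wedge v]=[Tu\wedge Tv]$. Let $\kappa:\mathbb{CP}^5\to(\mathbb{CP}^5)^\vee$, $\kappa[p_1:\dots:p_6]=[p_6:-p_5:p_4:p_3:-p_2:p_1]$.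 Then $A_-:=\kappa(G\cdot[1:0:0:0:0:-1])$, $A_{Q\smallsetminus N}:=\kappa(G\cdot[-1:0:-i:i:0:1])$, $A_{\mathrm{nd}}:=\kappa\big(\bigcup_{0<\lambda<1}G\cdot[-1:0:-i\lambda:i\lambda:0:1]\big)$. *)

theory Defs
  imports "HOL-Analysis.Analysis" "HOL-Library.Function_Algebras"
begin

section \<open>Quaternions\<close>

text \<open>
  The value \<open>Quat a b c d\<close> stands for \<open>a + b e\<^sub>1 + c e\<^sub>2 + d e\<^sub>3\<close> with Hamilton's units. The units
  \<open>i, j\<close> that enter the twistor transform are not these: they are an arbitrary anticommuting pair
  of imaginary units.
\<close>

datatype quat = Quat (qRe: real) (qIm1: real) (qIm2: real) (qIm3: real)

lemma quat_eq_iff: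
  "p = q \<longleftrightarrow> qRe p = qRe q \<and> qIm1 p = qIm1 q \<and> qIm2 p = qIm2 q \<and> qIm3 p = qIm3 q"
  by (cases p; cases q) auto

instantiation quat :: ab_group_add
begin
definition "0 = Quat 0 0 0 0"
definition "p + q = Quat (qRe p + qRe q) (qIm1 p + qIm1 q) (qIm2 p + qIm2 q) (qIm3 p + qIm3 q)"
definition "- p = Quat (- qRe p) (- qIm1 p) (- qIm2 p) (- qIm3 p)"
definition "p - q = Quat (qRe p - qRe q) (qIm1 p - qIm1 q) (qIm2 p - qIm2 q) (qIm3 p - qIm3 q)"
instance
  by standard (simp_all add: quat_eq_iff zero_quat_def plus_quat_def uminus_quat_def minus_quat_def)
end

lemma quat_add_sel [simp]:
  "qRe 0 = 0" "qIm1 0 = 0" "qIm2 0 = 0" "qIm3 0 = 0"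
  "qRe (p + q) = qRe p + qRe q" "qIm1 (p + q) = qIm1 p + qIm1 q"
  "qIm2 (p + q) = qIm2 p + qIm2 q" "qIm3 (p + q) = qIm3 p + qIm3 q"
  "qRe (- p) = - qRe p" "qIm1 (- p) = - qIm1 p" "qIm2 (- p) = - qIm2 p" "qIm3 (- p) = - qIm3 p"
  "qRe (p - q) = qRe p - qRe q" "qIm1 (p - q) = qIm1 p - qIm1 q"
  "qIm2 (p - q) = qIm2 p - qIm2 q" "qIm3 (p - q) = qIm3 p - qIm3 q"
  by (simp_all add: zero_quat_def plus_quat_def uminus_quat_def minus_quat_def)

instantiation quat :: ring_1
begin
definition "1 = Quat 1 0 0 0"
definition "p * q = Quat
   (qRe p * qRe q - qIm1 p * qIm1 q - qIm2 p * qIm2 q - qIm3 p * qIm3 q)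
   (qRe p * qIm1 q + qIm1 p * qRe q + qIm2 p * qIm3 q - qIm3 p * qIm2 q)
   (qRe p * qIm2 q - qIm1 p * qIm3 q + qIm2 p * qRe q + qIm3 p * qIm1 q)
   (qRe p * qIm3 q + qIm1 p * qIm2 q - qIm2 p * qIm1 q + qIm3 p * qRe q)"
instance
  by standard (simp_all add: quat_eq_iff one_quat_def times_quat_def algebra_simps)
end

lemma quat_mult_sel [simp]:
  "qRe 1 = 1" "qIm1 1 = 0" "qIm2 1 = 0" "qIm3 1 = 0"
  "qRe (p * q) = qRe p * qRe q - qIm1 p * qIm1 q - qIm2 p * qIm2 q - qIm3 p * qIm3 q"
  "qIm1 (p * q) = qRe p * qIm1 q + qIm1 p * qRe q + qIm2 p * qIm3 q - qIm3 p * qIm2 q"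
  "qIm2 (p * q) = qRe p * qIm2 q - qIm1 p * qIm3 q + qIm2 p * qRe q + qIm3 p * qIm1 q"
  "qIm3 (p * q) = qRe p * qIm3 q + qIm1 p * qIm2 q - qIm2 p * qIm1 q + qIm3 p * qRe q"
  by (simp_all add: one_quat_def times_quat_def)

instantiation quat :: real_algebra_1
begin
definition "r *\<^sub>R q = Quat (r * qRe q) (r * qIm1 q) (r * qIm2 q) (r * qIm3 q)"
instance
  by standard (simp_all add: quat_eq_iff scaleR_quat_def algebra_simps)
end

lemma quat_scaleR_sel [simp]:
  "qRe (r *\<^sub>R q) = r * qRe q" "qIm1 (r *\<^sub>R q) = r * qIm1 q"
  "qIm2 (r *\<^sub>R q) = r * qIm2 q" "qIm3 (r *\<^sub>R q) = r * qIm3 q"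
  by (simp_all add: scaleR_quat_def)

lemma quat_of_real_sel [simp]:
  "qRe (of_real r) = r" "qIm1 (of_real r) = 0" "qIm2 (of_real r) = 0" "qIm3 (of_real r) = 0"
  by (simp_all add: of_real_def)

instantiation quat :: real_div_algebra
begin
definition "inverse q = (let s = (qRe q)\<^sup>2 + (qIm1 q)\<^sup>2 + (qIm2 q)\<^sup>2 + (qIm3 q)\<^sup>2 in
   Quat (qRe q / s) (- qIm1 q / s) (- qIm2 q / s) (- qIm3 q / s))"
definition "p div q = p * inverse q" for p q :: quat
instance
proof
  fix q :: quat
  define s where "s = (qRe q)\<^sup>2 + (qIm1 q)\<^sup>2 + (qIm2 q)\<^sup>2 + (qIm3 q)\<^sup>2"
  define p where "p = Quat (qRe q) (- qIm1 q) (- qIm2 q) (- qIm3 q)"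
  have inv: "inverse q = (1 / s) *\<^sub>R p"
    by (simp add: quat_eq_iff inverse_quat_def Let_def s_def[symmetric] p_def)
  have "p * q = s *\<^sub>R 1" "q * p = s *\<^sub>R 1"
    by (simp_all add: quat_eq_iff p_def s_def power2_eq_square)
  moreover have "s \<noteq> 0" if "q \<noteq> 0"
    using that by (auto simp: s_def quat_eq_iff add_nonneg_eq_0_iff)
  ultimately show "inverse q * q = 1" "q * inverse q = 1" if "q \<noteq> 0"
    using that by (simp_all add: inv)
  show "inverse (0 :: quat) = 0"
    by (simp add: quat_eq_iff inverse_quat_def)
qed (rule divide_quat_def)
end

instantiation quat :: real_inner
begin
definition inner_quat_def:
  "inner p q = qRe p * qRe q + qIm1 p * qIm1 q + qIm2 p * qIm2 q + qIm3 p * qIm3 q" for p q :: quat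
definition norm_quat_def: "norm q = sqrt ((qRe q)\<^sup>2 + (qIm1 q)\<^sup>2 + (qIm2 q)\<^sup>2 + (qIm3 q)\<^sup>2)"
definition sgn_quat_def: "sgn q = q /\<^sub>R norm q" for q :: quat
definition dist_quat_def: "dist p q = norm (p - q)" for p q :: quat
definition uniformity_quat_def:
  "(uniformity :: (quat \<times> quat) filter) = (INF e\<in>{0 <..}. principal {(x, y). dist x y < e})"
definition open_quat_def:
  "open (U :: quat set) \<longleftrightarrow> (\<forall>x\<in>U. eventually (\<lambda>(x', y). x' = x \<longrightarrow> y \<in> U) uniformity)"
instance
proof
  fix x y z :: quat and r :: real
  show "inner x y = inner y x" "inner (x + y) z = inner x z + inner y z"
    "inner (r *\<^sub>R x) y = r * inner x y" "0 \<le> inner x x"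
    by (simp_all add: inner_quat_def algebra_simps)
  show "inner x x = 0 \<longleftrightarrow> x = 0"
    by (simp add: inner_quat_def quat_eq_iff add_nonneg_eq_0_iff)
  show "norm x = sqrt (inner x x)"
    by (simp add: inner_quat_def norm_quat_def power2_eq_square)
qed (rule sgn_quat_def dist_quat_def open_quat_def uniformity_quat_def)+
end

instance quat :: real_normed_div_algebra
proof
  fix x y :: quat
  have "(a*e - b*f - c*g - d*h)\<^sup>2 + (a*f + b*e + c*h - d*g)\<^sup>2
      + (a*g - b*h + c*e + d*f)\<^sup>2 + (a*h + b*g - c*f + d*e)\<^sup>2
      = (a\<^sup>2 + b\<^sup>2 + c\<^sup>2 + d\<^sup>2) * (e\<^sup>2 + f\<^sup>2 + g\<^sup>2 + h\<^sup>2)" for a b c d e f g h :: real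
    by (simp add: power2_eq_square algebra_simps)
  then show "norm (x * y) = norm x * norm y"
    unfolding norm_quat_def quat_mult_sel by (simp only: real_sqrt_mult)
qed

instantiation quat :: euclidean_space
begin
definition Basis_quat_def:
  "Basis = {Quat 1 0 0 0, Quat 0 1 0 0, Quat 0 0 1 0, Quat 0 0 0 1}"
instance
proof
  fix x u v :: quat
  show "u \<in> Basis \<Longrightarrow> v \<in> Basis \<Longrightarrow> inner u v = (if u = v then 1 else 0)"
    unfolding Basis_quat_def inner_quat_def by (elim insertE emptyE; simp)
  show "(\<forall>u\<in>Basis. inner x u = 0) \<longleftrightarrow> x = 0"
    unfolding quat_eq_iff[of x 0] by (simp add: Basis_quat_def inner_quat_def)
qed (simp_all add: Basis_quat_def)
end

lemma DIM_quat [simp]: "DIM(quat) = 4"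
  by (simp add: Basis_quat_def)


section \<open>Slices and the splitting of quaternions\<close>

definition imag_units :: "quat set" where
  "imag_units = {q. q\<^sup>2 = - 1}"

definition slice :: "quat \<Rightarrow> quat set" where
  "slice I = {of_real x + of_real y * I |x y. True}"

definition symmetric_slice_domain :: "quat set \<Rightarrow> bool" where
  "symmetric_slice_domain \<Omega> \<longleftrightarrow>
     open \<Omega> \<and> connected \<Omega> \<and> \<Omega> \<inter> \<real> \<noteq> {} \<and>
     (\<forall>I\<in>imag_units. openin (top_of_set (slice I)) (\<Omega> \<inter> slice I) \<and> connected (\<Omega> \<inter> slice I)) \<and>
     (\<forall>I\<in>imag_units. \<forall>I'\<in>imag_units. \<forall>x y.
        of_real x + of_real y * I \<in> \<Omega> \<longrightarrow> of_real x + of_real y * I' \<in> \<Omega>)"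

text \<open>The identification of \<^typ>\<open>complex\<close> with the subfield \<open>\<real> + \<real>i\<close> of the quaternions.\<close>

definition emb :: "quat \<Rightarrow> complex \<Rightarrow> quat" where
  "emb i z = of_real (Re z) + of_real (Im z) * i"

lemma emb_simps:
  assumes "i \<in> imag_units"
  shows "emb i (z + w) = emb i z + emb i w" "emb i (z - w) = emb i z - emb i w"
    "emb i (z * w) = emb i z * emb i w" "emb i 0 = 0" "emb i 1 = 1" "emb i \<i> = i"
    "emb i (z ^ m) = emb i z ^ m" "emb i (of_real r) = of_real r"
proof -
  show mult: "emb i (z * w) = emb i z * emb i w" for z w
  proof -
    have ii: "i * i = - 1"
      using assms by (simp add: imag_units_def power2_eq_square)
    have "emb i z = Re z *\<^sub>R 1 + Im z *\<^sub>R i" for z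
      by (simp add: emb_def scaleR_conv_of_real)
    then show ?thesis
      by (simp add: algebra_simps ii)
  qed
  show "emb i 1 = 1"
    by (simp add: emb_def)
  then show "emb i (z ^ m) = emb i z ^ m"
    by (induction m) (simp_all add: mult)
qed (simp_all add: emb_def algebra_simps)

lemma emb_eq_0_iff:
  assumes "i \<in> imag_units"
  shows "emb i z = 0 \<longleftrightarrow> z = 0"
proof
  assume "emb i z = 0"
  show "z = 0"
  proof (rule ccontr)
    assume "z \<noteq> 0"
    then have "emb i (inverse z) * emb i z = 1"
      by (simp add: emb_simps(5) emb_simps(3)[OF assms, symmetric] assms)
    with \<open>emb i z = 0\<close> show False by simp
  qed
qed (simp add: emb_simps assms)

lemma quat_eq_neg_self: "x = - x \<Longrightarrow> x = 0" for x :: quat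
  by (simp add: quat_eq_iff)

lemma quat_split_unique:
  assumes i: "i \<in> imag_units" and j: "j \<in> imag_units" and ij: "i * j = - (j * i)"
    and eq: "emb i b + emb i c * j = emb i b' + emb i c' * j"
  shows "b = b'" "c = c'"
proof -
  have ii: "i * i = - 1" and jj: "j * j = - 1"
    using i j by (simp_all add: imag_units_def power2_eq_square)
  define x y where "x = emb i (b - b')" and "y = emb i (c - c')"
  have comm: "emb i u * i = i * emb i u" for u
    using emb_simps(3,6)[OF i] by (metis mult.commute)
  have 0: "x + y * j = 0"
    using eq by (simp add: x_def y_def emb_simps(2)[OF i] algebra_simps)
  have xc: "x * i = i * x" and yc: "y * i = i * y"
    unfolding x_def y_def by (rule comm)+
  have "y * j * i = - (y * i * j)"
    using ij by (simp add: mult.assoc)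
  then have "y * j * i = - (i * (y * j))"
    by (simp add: yc mult.assoc)
  moreover have "y * j = - x"
    using 0 by (simp add: eq_neg_iff_add_eq_0 add.commute)
  ultimately have "x * i = - (x * i)"
    by (simp add: xc)
  then have "x * i = 0"
    by (rule quat_eq_neg_self)
  then have "x * (i * i) = 0"
    by (simp add: mult.assoc[symmetric])
  then have "x = 0"
    by (simp add: ii)
  with 0 have "y * (j * j) = 0"
    by (simp add: mult.assoc[symmetric])
  then have "y = 0"
    by (simp add: jj)
  have "b - b' = 0"
    by (rule iffD1[OF emb_eq_0_iff[OF i]]) (rule \<open>x = 0\<close>[unfolded x_def])
  then show "b = b'" by simp
  have "c - c' = 0"
    by (rule iffD1[OF emb_eq_0_iff[OF i]]) (rule \<open>y = 0\<close>[unfolded y_def])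
  then show "c = c'" by simp
qed

lemma quat_centralizer:
  assumes i: "i \<in> imag_units" and "x * i = i * x"
  shows "\<exists>z. x = emb i z"
proof -
  have sq: "qRe i * qRe i - qIm1 i * qIm1 i - qIm2 i * qIm2 i - qIm3 i * qIm3 i = - 1"
    "qRe i * qIm1 i = 0" "qRe i * qIm2 i = 0" "qRe i * qIm3 i = 0"
    using i by (auto simp: imag_units_def power2_eq_square quat_eq_iff)
  have re: "qRe i = 0"
  proof (rule ccontr)
    assume "qRe i \<noteq> 0"
    with sq have "qRe i * qRe i = - 1" by simp
    then show False
      using zero_le_square[of "qRe i"] by simp
  qed
  have s: "qIm1 i * qIm1 i + qIm2 i * qIm2 i + qIm3 i * qIm3 i = 1"
    using sq re by simp
  have c: "qIm2 x * qIm3 i = qIm3 x * qIm2 i" "qIm3 x * qIm1 i = qIm1 x * qIm3 i"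
    "qIm1 x * qIm2 i = qIm2 x * qIm1 i"
    using assms(2) re by (simp_all add: quat_eq_iff algebra_simps)
  define t where "t = qIm1 x * qIm1 i + qIm2 x * qIm2 i + qIm3 x * qIm3 i"
  have "t * qIm1 i = qIm1 x * (qIm1 i * qIm1 i + qIm2 i * qIm2 i + qIm3 i * qIm3 i)"
    unfolding t_def using c by algebra
  moreover have "t * qIm2 i = qIm2 x * (qIm1 i * qIm1 i + qIm2 i * qIm2 i + qIm3 i * qIm3 i)"
    unfolding t_def using c by algebra
  moreover have "t * qIm3 i = qIm3 x * (qIm1 i * qIm1 i + qIm2 i * qIm2 i + qIm3 i * qIm3 i)"
    unfolding t_def using c by algebra
  ultimately have "qIm1 x = t * qIm1 i" "qIm2 x = t * qIm2 i" "qIm3 x = t * qIm3 i"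
    using s by simp_all
  then have "x = emb i (Complex (qRe x) t)"
    by (simp add: emb_def quat_eq_iff re)
  then show ?thesis ..
qed

lemma quat_split_exists:
  assumes i: "i \<in> imag_units" and j: "j \<in> imag_units" and ij: "i * j = - (j * i)"
  shows "\<exists>b c. q = emb i b + emb i c * j"
proof -
  have ii: "i * i = - 1" and jj: "j * j = - 1"
    using i j by (simp_all add: imag_units_def power2_eq_square)
  have iix: "i * (i * x) = - x" for x
    by (simp add: mult.assoc[symmetric] ii)
  have ji: "j * i = - (i * j)" using ij by simp
  define w where "w = q + i * q * i"
  define x y where "x = (1/2) *\<^sub>R (q - i * q * i)" and "y = - ((1/2) *\<^sub>R (w * j))"
  have "x * i = i * x"
    by (simp add: x_def algebra_simps ii iix mult.assoc)
  then obtain b where b: "x = emb i b"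
    using quat_centralizer[OF i] by blast
  have "w * i = - (i * w)"
    by (simp add: w_def algebra_simps ii iix mult.assoc)
  then have "w * (i * j) = - (i * (w * j))"
    by (simp add: mult.assoc[symmetric])
  then have "y * i = i * y"
    by (simp add: y_def mult.assoc ji)
  then obtain c where c: "y = emb i c"
    using quat_centralizer[OF i] by blast
  have "q = x + y * j"
  proof -
    have "y * j = (1/2) *\<^sub>R w"
      by (simp add: y_def mult.assoc jj)
    then have "x + y * j = (1/2) *\<^sub>R (q - i * q * i + w)"
      by (simp only: x_def scaleR_add_right)
    also have "\<dots> = (1/2) *\<^sub>R (2 *\<^sub>R q)"
      by (simp add: w_def scaleR_2)
    finally show ?thesis by simp
  qed
  then show ?thesis using b c by blast
qed

text \<open>The components \<open>g, h\<close> of \<open>f(z) = g(z) + h(z) j\<close>.\<close>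

definition split_g :: "quat \<Rightarrow> quat \<Rightarrow> (quat \<Rightarrow> quat) \<Rightarrow> complex \<Rightarrow> complex" where
  "split_g i j f z = (THE b. \<exists>c. f (emb i z) = emb i b + emb i c * j)"

definition split_h :: "quat \<Rightarrow> quat \<Rightarrow> (quat \<Rightarrow> quat) \<Rightarrow> complex \<Rightarrow> complex" where
  "split_h i j f z = (THE c. \<exists>b. f (emb i z) = emb i b + emb i c * j)"

lemma split_g_h:
  assumes "i \<in> imag_units" "j \<in> imag_units" "i * j = - (j * i)"
  shows "f (emb i z) = emb i (split_g i j f z) + emb i (split_h i j f z) * j"
proof -
  obtain b c where bc: "f (emb i z) = emb i b + emb i c * j"
    using quat_split_exists[OF assms] by blast
  have "split_g i j f z = b" "split_h i j f z = c"
    unfolding split_g_def split_h_def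
    by (rule the_equality; use bc quat_split_unique[OF assms] in metis)+
  with bc show ?thesis by simp
qed

lemma split_poly:
  assumes "i \<in> imag_units" "j \<in> imag_units" "i * j = - (j * i)"
    and f: "f (emb i z) = (\<Sum>m\<le>n. emb i z ^ m * a m)"
  shows "split_g i j f z = (\<Sum>m\<le>n. z ^ m * split_g i j (\<lambda>_. a m) 0)"
    and "split_h i j f z = (\<Sum>m\<le>n. z ^ m * split_h i j (\<lambda>_. a m) 0)"
proof -
  let ?b = "\<lambda>m. split_g i j (\<lambda>_. a m) 0" and ?c = "\<lambda>m. split_h i j (\<lambda>_. a m) 0"
  have emb_sum: "emb i (\<Sum>m\<le>n. u m) = (\<Sum>m\<le>n. emb i (u m))" for u
    by (induction n) (simp_all add: emb_simps assms)
  have "f (emb i z) = (\<Sum>m\<le>n. emb i z ^ m * (emb i (?b m) + emb i (?c m) * j))"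
    unfolding f using split_g_h[OF assms(1-3), of "\<lambda>_. a _"] by simp
  also have "\<dots> = emb i (\<Sum>m\<le>n. z ^ m * ?b m) + emb i (\<Sum>m\<le>n. z ^ m * ?c m) * j"
    by (simp add: emb_sum emb_simps(3,7)[OF assms(1)] distrib_left sum.distrib sum_distrib_right
          mult.assoc)
  finally have "emb i (split_g i j f z) + emb i (split_h i j f z) * j
      = emb i (\<Sum>m\<le>n. z ^ m * ?b m) + emb i (\<Sum>m\<le>n. z ^ m * ?c m) * j"
    using split_g_h[OF assms(1-3), of f z] by simp
  from quat_split_unique[OF assms(1-3) this]
  show "split_g i j f z = (\<Sum>m\<le>n. z ^ m * ?b m)" "split_h i j f z = (\<Sum>m\<le>n. z ^ m * ?c m)" .
qed

lemma split_poly_holomorphic: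
  assumes "i \<in> imag_units" "j \<in> imag_units" "i * j = - (j * i)"
    and f: "\<And>q. q \<in> \<Omega> \<Longrightarrow> f q = (\<Sum>m\<le>n. q ^ m * a m)"
  shows "split_g i j f holomorphic_on {z. emb i z \<in> \<Omega>}"
    and "split_h i j f holomorphic_on {z. emb i z \<in> \<Omega>}"
proof -
  have "(\<lambda>z. \<Sum>m\<le>n. z ^ m * c m) holomorphic_on X" for c :: "nat \<Rightarrow> complex" and X
    by (intro holomorphic_intros)
  then show "split_g i j f holomorphic_on {z. emb i z \<in> \<Omega>}"
      "split_h i j f holomorphic_on {z. emb i z \<in> \<Omega>}"
    by (rule holomorphic_transform; simp add: split_poly[OF assms(1-3)] f)+
qed


section \<open>Projective spaces\<close>

text \<open>
  A point of the projectivization of a complex vector space, with scalar multiplication \<open>s\<close>, is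
  represented by the set of all its homogeneous coordinate vectors.
\<close>

definition hpoint :: "(complex \<Rightarrow> 'v \<Rightarrow> 'v) \<Rightarrow> 'v \<Rightarrow> 'v set" where
  "hpoint s x = {s c x |c. c \<noteq> 0}"

definition projectivization :: "(complex \<Rightarrow> 'v \<Rightarrow> 'v) \<Rightarrow> 'v::zero set \<Rightarrow> 'v set set" where
  "projectivization s A = hpoint s ` (A - {0})"

definition fscale :: "complex \<Rightarrow> ('a \<Rightarrow> complex) \<Rightarrow> 'a \<Rightarrow> complex" where
  "fscale c u = (\<lambda>x. c * u x)"

lemma vector_space_fscale: "vector_space (fscale :: complex \<Rightarrow> ('a \<Rightarrow> complex) \<Rightarrow> _)"
  by standard (simp_all add: fscale_def fun_eq_iff algebra_simps)

text \<open>Here \<open>\<complex>\<^bsup>m+1\<^esup>\<close> is the space of sequences supported on \<open>{0..m}\<close>.\<close>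

definition CP :: "nat \<Rightarrow> (nat \<Rightarrow> complex) set set" where
  "CP m = projectivization fscale {u. \<forall>k>m. u k = 0}"

abbreviation pt :: "complex^6 \<Rightarrow> (complex^6) set" where
  "pt \<equiv> hpoint (*s)"

lemma vector_6 [simp]:
  "(vector [x1, x2, x3, x4, x5, x6] :: ('a::zero)^6) $ 1 = x1"
  "(vector [x1, x2, x3, x4, x5, x6] :: ('a::zero)^6) $ 2 = x2"
  "(vector [x1, x2, x3, x4, x5, x6] :: ('a::zero)^6) $ 3 = x3"
  "(vector [x1, x2, x3, x4, x5, x6] :: ('a::zero)^6) $ 4 = x4"
  "(vector [x1, x2, x3, x4, x5, x6] :: ('a::zero)^6) $ 5 = x5"
  "(vector [x1, x2, x3, x4, x5, x6] :: ('a::zero)^6) $ 6 = x6"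
  unfolding vector_def by simp_all

lemma exhaust_6:
  fixes x :: 6
  shows "x = 1 \<or> x = 2 \<or> x = 3 \<or> x = 4 \<or> x = 5 \<or> x = 6"
proof (induct x)
  case (of_int z)
  then have "z = 0 \<or> z = 1 \<or> z = 2 \<or> z = 3 \<or> z = 4 \<or> z = 5" by fastforce
  then show ?case by auto
qed


section \<open>Twistor transform and hyperplane sections of the Grassmannian\<close>

definition Gr24 :: "(complex^6) set set" where
  "Gr24 = {pt \<zeta> |\<zeta>. \<zeta> \<noteq> 0 \<and> \<zeta>$1 * \<zeta>$6 - \<zeta>$2 * \<zeta>$5 + \<zeta>$3 * \<zeta>$4 = 0}"

definition hyperplane_section :: "complex^6 \<Rightarrow> (complex^6) set set" where
  "hyperplane_section z = Gr24 \<inter> {pt \<zeta> |\<zeta>. \<zeta> \<noteq> 0 \<and> (\<Sum>k\<in>UNIV. z$k * \<zeta>$k) = 0}"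

definition upper_part :: "quat \<Rightarrow> quat set \<Rightarrow> complex set" where
  "upper_part i \<Omega> = {v. Im v > 0 \<and> emb i v \<in> \<Omega>}"

definition hat :: "(complex \<Rightarrow> complex) \<Rightarrow> complex \<Rightarrow> complex" where
  "hat g z = cnj (g (cnj z))"

definition twistor :: "quat \<Rightarrow> quat \<Rightarrow> (quat \<Rightarrow> quat) \<Rightarrow> complex \<Rightarrow> (complex^6) set" where
  "twistor i j f v =
     (let g = split_g i j f; h = split_h i j f in
      pt (vector [g v * hat g v + h v * hat h v, h v, - g v, hat g v, hat h v, 1]))"

definition planar :: "quat \<Rightarrow> quat \<Rightarrow> quat set \<Rightarrow> (quat \<Rightarrow> quat) \<Rightarrow> bool" where
  "planar i j \<Omega> f \<longleftrightarrow>
     (\<exists>z. z \<noteq> 0 \<and> twistor i j f ` upper_part i \<Omega> \<subseteq> hyperplane_section z)"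

text \<open>The argument \<open>A\<close> is a subset of the dual projective space.\<close>

definition A_planar ::
    "(complex^6) set set \<Rightarrow> quat \<Rightarrow> quat \<Rightarrow> quat set \<Rightarrow> (quat \<Rightarrow> quat) \<Rightarrow> bool" where
  "A_planar A i j \<Omega> f \<longleftrightarrow>
     (\<exists>z. z \<noteq> 0 \<and> pt z \<in> A \<and> twistor i j f ` upper_part i \<Omega> \<subseteq> hyperplane_section z)"


section \<open>Real-linear maps from quaternions to complex numbers\<close>

definition lin_coeffs ::
    "quat \<Rightarrow> quat \<Rightarrow> (quat \<Rightarrow> complex) \<Rightarrow> complex \<times> complex \<times> complex \<times> complex" where
  "lin_coeffs i j \<Lambda> = (THE (z2, z3, z4, z5). \<forall>b c.
      \<Lambda> (emb i b + emb i c * j) = z2 * c - z3 * b + z4 * cnj b + z5 * cnj c)"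

lemma lin_coeffs_ex1:
  assumes "linear \<Lambda>"
  shows "\<exists>!(z2, z3, z4, z5). \<forall>b c.
      \<Lambda> (emb i b + emb i c * j) = z2 * c - z3 * b + z4 * cnj b + z5 * cnj c"
proof -
  define L where "L q = (\<Lambda> q - \<i> * \<Lambda> (i * q)) / 2" for q
  define L' where "L' q = (\<Lambda> q + \<i> * \<Lambda> (i * q)) / 2" for q
  have e: "\<Lambda> (emb i b * q) = L q * b + L' q * cnj b" for b q
  proof -
    have "emb i b * q = Re b *\<^sub>R q + Im b *\<^sub>R (i * q)"
      by (simp add: emb_def scaleR_conv_of_real distrib_right mult.assoc)
    then have "\<Lambda> (emb i b * q) = Re b * \<Lambda> q + Im b * \<Lambda> (i * q)"
      by (simp only: linear_add[OF assms] linear_scale[OF assms]) (simp add: scaleR_conv_of_real)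
    then show ?thesis
      by (simp add: L_def L'_def complex_eq_iff field_simps)
  qed
  have ex: "\<Lambda> (emb i b + emb i c * j) = L j * c - (- L 1) * b + L' 1 * cnj b + L' j * cnj c" for b c
    using e[of b 1] e[of c j] assms by (simp add: linear_add)
  show ?thesis
  proof (rule ex1I[of _ "(L j, - L 1, L' 1, L' j)"])
    show "case (L j, - L 1, L' 1, L' j) of (z2, z3, z4, z5) \<Rightarrow> \<forall>b c.
      \<Lambda> (emb i b + emb i c * j) = z2 * c - z3 * b + z4 * cnj b + z5 * cnj c"
      using ex by simp
  next
    fix t assume t: "case t of (z2, z3, z4, z5) \<Rightarrow> \<forall>b c.
      \<Lambda> (emb i b + emb i c * j) = z2 * c - z3 * b + z4 * cnj b + z5 * cnj c"
    obtain z2 z3 z4 z5 where t': "t = (z2, z3, z4, z5)" by (cases t) auto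
    have eq: "L j * c + L 1 * b + L' 1 * cnj b + L' j * cnj c
        = z2 * c - z3 * b + z4 * cnj b + z5 * cnj c" for b c
      using t ex[of b c] by (simp add: t')
    have *: "p = p' \<and> q = q'" if "p + q = p' + q'" "p * \<i> - q * \<i> = p' * \<i> - q' * \<i>"
      for p q p' q' :: complex
    proof -
      have "(p - q) * \<i> = (p' - q') * \<i>" using that(2) by (simp add: algebra_simps)
      then have "p - q = p' - q'" by simp
      with that(1) show ?thesis
        by (simp add: complex_eq_iff)
    qed
    show "t = (L j, - L 1, L' 1, L' j)"
      using *[of "L j" "L' j" z2 z5] *[of "L 1" "L' 1" "- z3" z4]
        eq[of 0 1] eq[of 0 \<i>] eq[of 1 0] eq[of \<i> 0]
      by (auto simp: t')
  qed
qed

definition lin_disc :: "quat \<Rightarrow> quat \<Rightarrow> (quat \<Rightarrow> complex) \<Rightarrow> complex" where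
  "lin_disc i j \<Lambda> = (case lin_coeffs i j \<Lambda> of (z2, z3, z4, z5) \<Rightarrow> z3 * z4 - z2 * z5)"

definition lin_rank :: "(quat \<Rightarrow> complex) \<Rightarrow> nat" where
  "lin_rank \<Lambda> = dim (range \<Lambda>)"

text \<open>The vector \<open>z\<^bsub>\<Lambda>,f\<^esub>\<close>, where \<open>a0\<close> is the constant coefficient of \<open>f\<close>.\<close>

definition lin_vec :: "quat \<Rightarrow> quat \<Rightarrow> quat \<Rightarrow> (quat \<Rightarrow> complex) \<Rightarrow> complex^6" where
  "lin_vec i j a0 \<Lambda> =
     (case lin_coeffs i j \<Lambda> of (z2, z3, z4, z5) \<Rightarrow> vector [0, z2, z3, z4, z5, - \<Lambda> a0])"


section \<open>Types of hyperplane sections\<close>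

definition quat_block :: "complex \<Rightarrow> complex \<Rightarrow> complex \<Rightarrow> complex \<Rightarrow> bool" where
  "quat_block p q r s \<longleftrightarrow> (\<exists>z w. p = z \<and> q = - cnj w \<and> r = w \<and> s = cnj z)"

definition GL2H :: "(complex^4^4) set" where
  "GL2H = {T. invertible T \<and>
     (\<forall>m\<in>{1, 3}. \<forall>n\<in>{1, 3}. quat_block (T$m$n) (T$m$(n+1)) (T$(m+1)$n) (T$(m+1)$(n+1)))}"

text \<open>Elements of \<open>PGL(2,H)\<close> are the classes of elements of \<^const>\<open>GL2H\<close> modulo non-zero real scalars.\<close>

definition PGL2H :: "(complex^4^4) set set" where
  "PGL2H = (\<lambda>T. {c *\<^sub>R T |c. c \<noteq> 0}) ` GL2H"

text \<open>
  The coordinates of \<open>u \<and> v\<close> in the basis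
  \<open>e\<^sub>3\<and>e\<^sub>4, -e\<^sub>2\<and>e\<^sub>4, e\<^sub>2\<and>e\<^sub>3, e\<^sub>1\<and>e\<^sub>4, -e\<^sub>1\<and>e\<^sub>3, e\<^sub>1\<and>e\<^sub>2\<close> of \<open>\<Lambda>\<^sup>2\<complex>\<^sup>4\<close>.
\<close>

definition wedge :: "complex^4 \<Rightarrow> complex^4 \<Rightarrow> complex^6" where
  "wedge u v = vector
     [u$3 * v$4 - u$4 * v$3, - (u$2 * v$4 - u$4 * v$2), u$2 * v$3 - u$3 * v$2,
      u$1 * v$4 - u$4 * v$1, - (u$1 * v$3 - u$3 * v$1), u$1 * v$2 - u$2 * v$1]"

text \<open>The map induced by \<open>T\<close> on \<open>\<Lambda>\<^sup>2\<complex>\<^sup>4\<close>, given on the basis and extended linearly.\<close>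

definition ext_square :: "complex^4^4 \<Rightarrow> complex^6 \<Rightarrow> complex^6" where
  "ext_square T \<zeta> =
     (let e = (\<lambda>k. T *v axis k 1) in
        \<zeta>$1 *s wedge (e 3) (e 4) + \<zeta>$2 *s (- wedge (e 2) (e 4)) + \<zeta>$3 *s wedge (e 2) (e 3)
      + \<zeta>$4 *s wedge (e 1) (e 4) + \<zeta>$5 *s (- wedge (e 1) (e 3)) + \<zeta>$6 *s wedge (e 1) (e 2))"

lemma wedge_nth:
  "wedge u v $ 1 = u$3 * v$4 - u$4 * v$3" "wedge u v $ 2 = - (u$2 * v$4 - u$4 * v$2)"
  "wedge u v $ 3 = u$2 * v$3 - u$3 * v$2" "wedge u v $ 4 = u$1 * v$4 - u$4 * v$1"
  "wedge u v $ 5 = - (u$1 * v$3 - u$3 * v$1)" "wedge u v $ 6 = u$1 * v$2 - u$2 * v$1"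
  unfolding wedge_def by (rule vector_6)+

lemma ext_square_wedge: "ext_square T (wedge u v) = wedge (T *v u) (T *v v)"
proof -
  define a where "a k m = T $ m $ k" for k m
  have col: "(T *v axis k 1) $ m = a k m" for k m
    by (simp add: a_def matrix_vector_mult_def axis_def if_distrib cong: if_cong)
  have mv: "(T *v x) $ m = a 1 m * x$1 + a 2 m * x$2 + a 3 m * x$3 + a 4 m * x$4" for x m
    by (simp add: a_def matrix_vector_mult_def sum_4)
  have
    "ext_square T (wedge u v) $ 1 = wedge (T *v u) (T *v v) $ 1"
    "ext_square T (wedge u v) $ 2 = wedge (T *v u) (T *v v) $ 2"
    "ext_square T (wedge u v) $ 3 = wedge (T *v u) (T *v v) $ 3"
    "ext_square T (wedge u v) $ 4 = wedge (T *v u) (T *v v) $ 4"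
    "ext_square T (wedge u v) $ 5 = wedge (T *v u) (T *v v) $ 5"
    "ext_square T (wedge u v) $ 6 = wedge (T *v u) (T *v v) $ 6"
    unfolding ext_square_def Let_def vector_add_component vector_smult_component
      vector_uminus_component wedge_nth col
    unfolding mv by algebra+
  then have "ext_square T (wedge u v) $ k = wedge (T *v u) (T *v v) $ k" for k
    using exhaust_6[of k] by metis
  then show ?thesis by (simp add: vec_eq_iff)
qed

text \<open>The action of a class \<open>C\<close> in \<open>PGL(2,H)\<close> on a point, and the orbit of a point.\<close>

definition PGL2H_act :: "(complex^4^4) set \<Rightarrow> (complex^6) set \<Rightarrow> (complex^6) set" where
  "PGL2H_act C P = {ext_square T \<zeta> |T \<zeta>. T \<in> C \<and> \<zeta> \<in> P}"

definition PGL2H_orbit :: "(complex^6) set \<Rightarrow> (complex^6) set set" where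
  "PGL2H_orbit P = (\<lambda>C. PGL2H_act C P) ` PGL2H"

definition kappa :: "(complex^6) set \<Rightarrow> (complex^6) set" where
  "kappa P = (\<lambda>p. vector [p$6, - p$5, p$4, p$3, - p$2, p$1]) ` P"

definition A_minus :: "(complex^6) set set" where
  "A_minus = kappa ` PGL2H_orbit (pt (vector [1, 0, 0, 0, 0, - 1]))"

definition A_QN :: "(complex^6) set set" where
  "A_QN = kappa ` PGL2H_orbit (pt (vector [- 1, 0, - \<i>, \<i>, 0, 1]))"

definition A_nd :: "(complex^6) set set" where
  "A_nd = kappa ` (\<Union>l\<in>{0<..<1::real}.
     PGL2H_orbit (pt (vector [- 1, 0, - \<i> * of_real l, \<i> * of_real l, 0, 1])))"

end

theory Submission
  imports Defs
begin

text \<open>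
  Write \<open>\<Lambda>\<^sub>z(b + c j) = z\<^sub>2 c - z\<^sub>3 b + z\<^sub>4 cnj b + z\<^sub>5 cnj c\<close>. Along the twistor curve of
  \<open>f(q) = \<Sum> q\<^sup>m a\<^sub>m\<close> the equation of the hyperplane \<open>z\<close> is the polynomial
  \<open>z\<^sub>1 (g hat(g) + h hat(h)) + \<Sum> v\<^sup>m \<Lambda>\<^sub>z(a\<^sub>m) + z\<^sub>6\<close> in \<open>v\<close>. Its top coefficient is
  \<open>z\<^sub>1 \<bar>a\<^sub>d\<bar>\<^sup>2\<close> with \<open>d = deg f\<close>, so the curve lies in the section if and only if \<open>z\<^sub>1 = 0\<close>, \<open>\<Lambda>\<^sub>z\<close>
  vanishes on \<open>a\<^sub>1, \<dots>, a\<^sub>n\<close>, and \<open>z\<^sub>6 = - \<Lambda>\<^sub>z(a\<^sub>0)\<close> (\<open>twistor_curve_in_section_iff\<close>). This is the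
  parametrization of the sections by \<open>\<Lambda>\<close>. It is injective on points because a hyperplane with
  \<open>z\<^sub>1 = 0\<close> can be recovered from its trace on an affine chart of the quadric
  (\<open>hyperplane_section_eq_imp\<close>), and the space of these \<open>\<Lambda>\<close> has complex dimension \<open>4 - r\<close> because
  \<open>\<Lambda>\<close> is given by arbitrary values on an orthonormal basis of the complement of \<open>S\<close>
  (\<open>annihilator_parametrization\<close>). Planarity provides a non-zero \<open>\<Lambda>\<close>, whence \<open>r \<le> 3\<close>.

  For the types, split \<open>\<Lambda> = \<alpha> + \<i> \<beta>\<close> into real and imaginary parts, regarded as quaternions by means
  of the inner product. Then \<open>- \<Delta>(\<Lambda>) = \<bar>\<alpha>\<bar>\<^sup>2 - \<bar>\<beta>\<bar>\<^sup>2 + 2 \<i> \<langle>\<alpha>, \<beta>\<rangle>\<close>, up to the normalization of the inner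
  product. Multiplying \<open>\<Lambda>\<close> by a suitable complex number makes this number real and non-negative,
  which means \<open>\<alpha> \<bottom> \<beta>\<close> and \<open>\<bar>\<beta>\<bar> \<le> \<bar>\<alpha>\<bar>\<close>. So \<open>\<beta> = \<lambda> k \<alpha>\<close> with \<open>0 \<le> \<lambda> \<le> 1\<close> and an imaginary unit \<open>k\<close>
  (\<open>linear_form_normal_form\<close>). An explicit element of \<open>GL(2,H)\<close>, built from \<open>\<alpha>\<close>, \<open>k\<close> and \<open>a\<^sub>0\<close>,
  carries the base point with parameter \<open>\<lambda>\<close> to the section of \<open>\<Lambda>\<close> (\<open>normal_point_orbit\<close>). In these
  terms rank 1 means \<open>\<lambda> = 0\<close>, and \<open>\<Delta>(\<Lambda>) = 0\<close> means \<open>\<lambda> = 1\<close>; these are the three types.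
\<close>

section \<open>Complex coordinates of quaternions and of real-linear forms\<close>

definition part_1 :: "quat \<Rightarrow> quat \<Rightarrow> quat \<Rightarrow> complex" where
  "part_1 i j q = split_g i j (\<lambda>_. q) 0"

definition part_j :: "quat \<Rightarrow> quat \<Rightarrow> quat \<Rightarrow> complex" where
  "part_j i j q = split_h i j (\<lambda>_. q) 0"

text \<open>
  The coefficients are numbered as in \<^const>\<open>lin_vec\<close>, so that \<open>coord_form\<close> recovers a real-linear map
  from its vector.
\<close>

definition coord_form :: "quat \<Rightarrow> quat \<Rightarrow> complex^6 \<Rightarrow> quat \<Rightarrow> complex" where
  "coord_form i j z q =
     z$2 * part_j i j q - z$3 * part_1 i j q + z$4 * cnj (part_1 i j q) + z$5 * cnj (part_j i j q)"

lemma vec6_eqI: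
  fixes u v :: "'a^6"
  assumes "u$1 = v$1" "u$2 = v$2" "u$3 = v$3" "u$4 = v$4" "u$5 = v$5" "u$6 = v$6"
  shows "u = v"
proof -
  have "u$k = v$k" for k
    using exhaust_6[of k] assms by auto
  then show ?thesis
    by (simp add: vec_eq_iff)
qed

lemma UNIV_6: "(UNIV :: 6 set) = {1, 2, 3, 4, 5, 6}"
  using exhaust_6 by auto

lemma sum_6: "(\<Sum>k\<in>UNIV. F k) = F 1 + F 2 + F 3 + F 4 + F 5 + F (6::6)"
  unfolding UNIV_6 by (simp add: ac_simps)

context
  fixes i j :: quat
  assumes i: "i \<in> imag_units" and j: "j \<in> imag_units" and ij: "i * j = - (j * i)"
begin

lemma parts_decomp: "q = emb i (part_1 i j q) + emb i (part_j i j q) * j"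
  unfolding part_1_def part_j_def using split_g_h[OF i j ij, of "\<lambda>_. q" 0] by simp

lemma parts_eqI:
  assumes "q = emb i b + emb i c * j"
  shows "part_1 i j q = b" "part_j i j q = c"
  by (rule quat_split_unique[OF i j ij trans[OF parts_decomp[symmetric] assms]])+

lemma parts_add:
  "part_1 i j (p + q) = part_1 i j p + part_1 i j q"
  "part_j i j (p + q) = part_j i j p + part_j i j q"
proof -
  have "p + q = emb i (part_1 i j p + part_1 i j q) + emb i (part_j i j p + part_j i j q) * j"
    by (subst parts_decomp[of p], subst parts_decomp[of q]) (simp add: emb_simps[OF i] algebra_simps)
  from parts_eqI[OF this] show
    "part_1 i j (p + q) = part_1 i j p + part_1 i j q"
    "part_j i j (p + q) = part_j i j p + part_j i j q" .
qed

lemma parts_scaleR: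
  "part_1 i j (r *\<^sub>R q) = r * part_1 i j q"
  "part_j i j (r *\<^sub>R q) = r * part_j i j q"
proof -
  have "r *\<^sub>R q = emb i (r * part_1 i j q) + emb i (r * part_j i j q) * j"
    by (subst parts_decomp[of q])
      (simp add: emb_simps(3,8)[OF i] scaleR_conv_of_real algebra_simps)
  from parts_eqI[OF this] show
    "part_1 i j (r *\<^sub>R q) = r * part_1 i j q" "part_j i j (r *\<^sub>R q) = r * part_j i j q" .
qed

lemma parts_eq_0_iff: "part_1 i j q = 0 \<and> part_j i j q = 0 \<longleftrightarrow> q = 0"
proof
  assume "part_1 i j q = 0 \<and> part_j i j q = 0"
  then show "q = 0"
    by (subst parts_decomp[of q]) (simp add: emb_simps(4)[OF i])
next
  assume "q = 0"
  then show "part_1 i j q = 0 \<and> part_j i j q = 0"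
    using parts_eqI[of q 0 0] by (simp add: emb_simps(4)[OF i])
qed

lemma linear_coord_form: "linear (coord_form i j z)"
proof (rule linearI)
  show "coord_form i j z (p + q) = coord_form i j z p + coord_form i j z q" for p q
    by (simp add: coord_form_def parts_add algebra_simps)
  show "coord_form i j z (r *\<^sub>R q) = r *\<^sub>R coord_form i j z q" for r q
    unfolding coord_form_def parts_scaleR by (simp add: scaleR_conv_of_real algebra_simps)
qed

lemma coord_form_emb:
  "coord_form i j z (emb i b + emb i c * j) = z$2 * c - z$3 * b + z$4 * cnj b + z$5 * cnj c"
  using parts_eqI[OF refl, of b c] by (simp add: coord_form_def)

lemma lin_coeffs_unique:
  assumes "linear \<Lambda>"
    and "\<And>b c. \<Lambda> (emb i b + emb i c * j) = z2 * c - z3 * b + z4 * cnj b + z5 * cnj c"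
  shows "lin_coeffs i j \<Lambda> = (z2, z3, z4, z5)"
  unfolding lin_coeffs_def
  by (rule the1_equality[OF lin_coeffs_ex1[OF assms(1)]]) (simp add: assms(2))

lemma lin_coeffs_coord_form: "lin_coeffs i j (coord_form i j z) = (z$2, z$3, z$4, z$5)"
  by (rule lin_coeffs_unique[OF linear_coord_form]) (rule coord_form_emb)

lemma coord_form_lin_vec:
  assumes "linear \<Lambda>"
  shows "coord_form i j (lin_vec i j p \<Lambda>) = \<Lambda>"
proof
  fix q
  obtain z2 z3 z4 z5 where z: "lin_coeffs i j \<Lambda> = (z2, z3, z4, z5)"
    by (cases "lin_coeffs i j \<Lambda>") auto
  have "\<Lambda> (emb i b + emb i c * j) = z2 * c - z3 * b + z4 * cnj b + z5 * cnj c" for b c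
    using theI'[OF lin_coeffs_ex1[OF assms, of i j]] z unfolding lin_coeffs_def by simp
  then have eq: "coord_form i j (lin_vec i j p \<Lambda>) (emb i b + emb i c * j) = \<Lambda> (emb i b + emb i c * j)"
    for b c
    unfolding coord_form_emb by (simp add: lin_vec_def z)
  show "coord_form i j (lin_vec i j p \<Lambda>) q = \<Lambda> q"
    using eq[of "part_1 i j q" "part_j i j q"] unfolding parts_decomp[of q, symmetric] .
qed

lemma lin_vec_nth:
  "lin_vec i j p \<Lambda> $ 1 = 0" "lin_vec i j p \<Lambda> $ 6 = - \<Lambda> p"
  by (simp_all add: lin_vec_def split: prod.split)

lemma lin_vec_coord_form:
  assumes "z$1 = 0" "z$6 = - coord_form i j z p"
  shows "lin_vec i j p (coord_form i j z) = z"
  by (rule vec6_eqI) (simp_all add: lin_vec_def lin_coeffs_coord_form assms)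

lemma coord_form_smult: "coord_form i j (c *s z) = fscale c (coord_form i j z)"
  by (simp add: fun_eq_iff coord_form_def fscale_def algebra_simps)

lemma lin_vec_fscale:
  assumes "linear \<Lambda>"
  shows "lin_vec i j p (fscale c \<Lambda>) = c *s lin_vec i j p \<Lambda>"
proof -
  let ?z = "c *s lin_vec i j p \<Lambda>"
  have "coord_form i j ?z = fscale c \<Lambda>"
    by (simp add: coord_form_smult coord_form_lin_vec[OF assms])
  moreover from this have "lin_vec i j p (coord_form i j ?z) = ?z"
    by (intro lin_vec_coord_form) (simp_all add: lin_vec_nth fscale_def)
  ultimately show ?thesis
    by simp
qed

lemma lin_disc_eq:
  assumes "z = lin_vec i j p \<Lambda>"
  shows "lin_disc i j \<Lambda> = z$3 * z$4 - z$2 * z$5"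
  by (simp add: assms lin_disc_def lin_vec_def split: prod.split)

end


section \<open>Points and hyperplane sections in homogeneous coordinates\<close>

lemma hpoint_eq_iff:
  assumes "vector_space s"
  shows "hpoint s x = hpoint s y \<longleftrightarrow> (\<exists>c. c \<noteq> 0 \<and> y = s c x)"
proof
  interpret vector_space s by fact
  assume "hpoint s x = hpoint s y"
  moreover have "s 1 y \<in> hpoint s y"
    unfolding hpoint_def by (intro CollectI exI[of _ 1]) simp
  ultimately show "\<exists>c. c \<noteq> 0 \<and> y = s c x"
    by (auto simp: hpoint_def)
next
  interpret vector_space s by fact
  assume "\<exists>c. c \<noteq> 0 \<and> y = s c x"
  then obtain c where c: "c \<noteq> 0" "y = s c x" by blast
  show "hpoint s x = hpoint s y"
  proof
    show "hpoint s x \<subseteq> hpoint s y"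
    proof
      fix p assume "p \<in> hpoint s x"
      then obtain d where "d \<noteq> 0" "p = s d x"
        by (auto simp: hpoint_def)
      with c have "d / c \<noteq> 0" "p = s (d / c) y"
        by simp_all
      then show "p \<in> hpoint s y"
        unfolding hpoint_def by blast
    qed
    show "hpoint s y \<subseteq> hpoint s x"
    proof
      fix p assume "p \<in> hpoint s y"
      then obtain d where "d \<noteq> 0" "p = s d y"
        by (auto simp: hpoint_def)
      with c have "d * c \<noteq> 0" "p = s (d * c) x"
        by simp_all
      then show "p \<in> hpoint s x"
        unfolding hpoint_def by blast
    qed
  qed
qed

lemmas pt_eq_iff = hpoint_eq_iff[OF vec.vector_space_axioms]

lemma pt_in_hyperplane_section_iff:
  assumes "\<zeta> \<noteq> 0" "\<zeta>$1 * \<zeta>$6 - \<zeta>$2 * \<zeta>$5 + \<zeta>$3 * \<zeta>$4 = 0"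
  shows "pt \<zeta> \<in> hyperplane_section z \<longleftrightarrow> (\<Sum>k\<in>UNIV. z$k * \<zeta>$k) = 0"
proof -
  have "pt \<zeta> \<in> Gr24"
    using assms by (auto simp: Gr24_def)
  moreover have "(\<Sum>k\<in>UNIV. z$k * \<zeta>$k) = 0"
    if "pt \<zeta> = pt \<xi>" "(\<Sum>k\<in>UNIV. z$k * \<xi>$k) = 0" for \<xi>
  proof -
    obtain c where c: "c \<noteq> 0" "\<xi> = c *s \<zeta>"
      using \<open>pt \<zeta> = pt \<xi>\<close> pt_eq_iff by blast
    have "(\<Sum>k\<in>UNIV. z$k * \<xi>$k) = c * (\<Sum>k\<in>UNIV. z$k * \<zeta>$k)"
      by (simp add: c sum_distrib_left mult.left_commute)
    with that c show ?thesis by simp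
  qed
  ultimately show ?thesis
    using assms by (auto simp: hyperplane_section_def)
qed

lemma hyperplane_section_smult:
  assumes "c \<noteq> 0"
  shows "hyperplane_section (c *s z) = hyperplane_section z"
proof -
  have "(\<Sum>k\<in>UNIV. (c *s z)$k * \<zeta>$k) = c * (\<Sum>k\<in>UNIV. z$k * \<zeta>$k)" for \<zeta>
    by (simp add: sum_distrib_left mult.assoc)
  with assms show ?thesis
    by (simp add: hyperplane_section_def)
qed

text \<open>
  The affine chart \<open>\<zeta>\<^sub>6 = 1\<close> of the quadric is a copy of \<open>\<complex>\<^sup>4\<close>, because there \<open>\<zeta>\<^sub>1\<close> is a function
  of the other coordinates. If \<open>z\<^sub>1 = 0\<close> and \<open>z\<^sub>2, \<dots>, z\<^sub>5\<close> are not all zero, then \<open>z\<close> cuts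
  out an affine hyperplane of this chart, and an affine hyperplane determines its equation up to a factor.
\<close>

lemma hyperplane_section_eq_imp:
  fixes z z' :: "complex^6"
  assumes z: "z$1 = 0" "(z$2, z$3, z$4, z$5) \<noteq> (0, 0, 0, 0)"
    and z': "z'$1 = 0" "(z'$2, z'$3, z'$4, z'$5) \<noteq> (0, 0, 0, 0)"
    and eq: "hyperplane_section z = hyperplane_section z'"
  shows "\<exists>c. c \<noteq> 0 \<and> z' = c *s z"
proof -
  define l where "l y p q r s = y$2 * p + y$3 * q + y$4 * r + y$5 * s + y$6"
    for y :: "complex^6" and p q r s
  have chart: "l y p q r s = 0 \<longleftrightarrow>
      pt (vector [p * s - q * r, p, q, r, s, 1]) \<in> hyperplane_section y" if "y$1 = 0" for y p q r s
  proof -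
    let ?\<zeta> = "vector [p * s - q * r, p, q, r, s, 1] :: complex^6"
    have "?\<zeta> $ 6 \<noteq> 0 $ 6" by simp
    then have "?\<zeta> \<noteq> 0" by metis
    then show ?thesis
      by (simp add: pt_in_hyperplane_section_iff sum_6 l_def that)
  qed
  have zeros: "l z p q r s = 0 \<Longrightarrow> l z' p q r s = 0" for p q r s
    using chart[OF z(1)] chart[OF z'(1)] eq by simp
  \<comment> \<open>The vector \<open>w\<close> will satisfy \<open>z\<^sub>2 w\<^sub>2 + \<dots> + z\<^sub>5 w\<^sub>5 = 1\<close>, so that every point of the chart can be
    moved along \<open>w\<close> into the zero set of \<open>l z\<close>, where \<open>l z'\<close> vanishes as well.\<close>
  define N where "N = z$2 * cnj (z$2) + z$3 * cnj (z$3) + z$4 * cnj (z$4) + z$5 * cnj (z$5)"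
  have "N = of_real ((cmod (z$2))\<^sup>2 + (cmod (z$3))\<^sup>2 + (cmod (z$4))\<^sup>2 + (cmod (z$5))\<^sup>2)"
    by (simp only: N_def of_real_add complex_norm_square)
  then have "N \<noteq> 0"
    using z(2) by (auto simp del: of_real_add of_real_power simp: add_nonneg_eq_0_iff)
  define w where "w k = cnj (z$k) / N" for k
  have zw: "z$2 * w 2 + z$3 * w 3 + z$4 * w 4 + z$5 * w 5 = 1"
    using \<open>N \<noteq> 0\<close> by (simp add: w_def N_def add_divide_distrib[symmetric])
  define c where "c = z'$2 * w 2 + z'$3 * w 3 + z'$4 * w 4 + z'$5 * w 5"
  have ratio: "l z' p q r s = c * l z p q r s" for p q r s
  proof -
    let ?t = "l z p q r s"
    have "l z (p - ?t * w 2) (q - ?t * w 3) (r - ?t * w 4) (s - ?t * w 5)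
        = ?t - ?t * (z$2 * w 2 + z$3 * w 3 + z$4 * w 4 + z$5 * w 5)"
      by (simp add: l_def algebra_simps)
    then have "l z' (p - ?t * w 2) (q - ?t * w 3) (r - ?t * w 4) (s - ?t * w 5) = 0"
      by (intro zeros) (simp add: zw)
    moreover have "l z' (p - t * w 2) (q - t * w 3) (r - t * w 4) (s - t * w 5)
        = l z' p q r s - c * t" for t
      by (simp add: l_def c_def algebra_simps)
    ultimately show ?thesis by simp
  qed
  have "z' = c *s z"
    using ratio[of 0 0 0 0] ratio[of 1 0 0 0] ratio[of 0 1 0 0] ratio[of 0 0 1 0] ratio[of 0 0 0 1]
    by (intro vec6_eqI) (simp_all add: l_def z(1) z'(1) algebra_simps)
  moreover from this z'(2) have "c \<noteq> 0" by auto
  ultimately show ?thesis by blast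
qed

section \<open>Hyperplane sections that contain the twistor transform\<close>

lemma coeff_mult_top:
  fixes p q :: "'a::comm_semiring_0 poly"
  assumes "\<And>m. m > d \<Longrightarrow> coeff p m = 0" "\<And>m. m > d \<Longrightarrow> coeff q m = 0"
  shows "coeff (p * q) (2 * d) = coeff p d * coeff q d"
proof -
  have "coeff p m * coeff q (2 * d - m) = 0" if "m \<le> 2 * d" "m \<noteq> d" for m
    using that assms(1)[of m] assms(2)[of "2 * d - m"] by (cases "m < d") simp_all
  then have "(\<Sum>m\<le>2 * d. coeff p m * coeff q (2 * d - m))
      = (\<Sum>m\<in>{d}. coeff p m * coeff q (2 * d - m))"
    by (intro sum.mono_neutral_right) auto
  then show ?thesis
    by (simp add: coeff_mult mult_2)
qed

context
  fixes i j :: quat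
  assumes i: "i \<in> imag_units" and j: "j \<in> imag_units" and ij: "i * j = - (j * i)"
begin

lemma infinite_upper_part:
  assumes "symmetric_slice_domain \<Omega>"
  shows "infinite (upper_part i \<Omega>)"
proof -
  have op: "open \<Omega>" and re: "\<Omega> \<inter> \<real> \<noteq> {}"
    using assms by (auto simp: symmetric_slice_domain_def)
  obtain x where x: "of_real x \<in> \<Omega>"
    using re by (auto elim: Reals_cases)
  obtain e where e: "e > 0" "ball (of_real x) e \<subseteq> \<Omega>"
    using op x open_contains_ball by blast
  have "(norm i)\<^sup>2 = 1"
    using i by (simp add: imag_units_def norm_power[symmetric])
  then have "norm i = 1"
    by (simp add: power2_eq_1_iff) (use norm_ge_zero[of i] in linarith)
  have "Complex x y \<in> upper_part i \<Omega>" if "y \<in> {0<..<e}" for y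
  proof -
    have "dist (of_real x) (emb i (Complex x y)) < e"
      using that \<open>norm i = 1\<close> by (simp add: emb_def dist_norm norm_mult)
    then show ?thesis
      using that e by (auto simp: upper_part_def)
  qed
  then have "Complex x ` {0<..<e} \<subseteq> upper_part i \<Omega>"
    by blast
  moreover have "infinite (Complex x ` {0<..<e})"
    using e(1) by (subst finite_image_iff) (auto simp: inj_on_def infinite_Ioo)
  ultimately show ?thesis
    using finite_subset by blast
qed

text \<open>
  The conjugate point lies in \<open>\<Omega>\<close> because conjugation of \<open>x + y i\<close> replaces the unit \<open>i\<close> by \<open>- i\<close>.
\<close>

lemma upper_part_cnj:
  assumes "symmetric_slice_domain \<Omega>" "v \<in> upper_part i \<Omega>"
  shows "emb i v \<in> \<Omega>" "emb i (cnj v) \<in> \<Omega>"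
proof -
  show v: "emb i v \<in> \<Omega>"
    using assms(2) by (simp add: upper_part_def)
  have neg: "- i \<in> imag_units"
    using i by (simp add: imag_units_def)
  have eq: "emb i (cnj v) = of_real (Re v) + of_real (Im v) * - i"
    by (simp add: emb_def)
  have sym: "\<forall>I\<in>imag_units. \<forall>I'\<in>imag_units. \<forall>x y.
      of_real x + of_real y * I \<in> \<Omega> \<longrightarrow> of_real x + of_real y * I' \<in> \<Omega>"
    using assms(1) unfolding symmetric_slice_domain_def by (elim conjE)
  show "emb i (cnj v) \<in> \<Omega>"
    unfolding eq using sym[rule_format, OF i neg v[unfolded emb_def]] .
qed

lemma twistor_in_section_iff:
  fixes a :: "nat \<Rightarrow> quat" and v :: complex and n :: nat
  defines "g \<equiv> \<Sum>m\<le>n. v ^ m * part_1 i j (a m)" and "g' \<equiv> \<Sum>m\<le>n. v ^ m * cnj (part_1 i j (a m))"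
    and "h \<equiv> \<Sum>m\<le>n. v ^ m * part_j i j (a m)" and "h' \<equiv> \<Sum>m\<le>n. v ^ m * cnj (part_j i j (a m))"
  assumes \<Omega>: "symmetric_slice_domain \<Omega>" and f: "\<forall>q\<in>\<Omega>. f q = (\<Sum>m\<le>n. q ^ m * a m)"
    and v: "v \<in> upper_part i \<Omega>"
  shows "twistor i j f v \<in> hyperplane_section z \<longleftrightarrow>
    z$1 * (g * g' + h * h') + (\<Sum>m\<le>n. v ^ m * coord_form i j z (a m)) + z$6 = 0"
proof -
  note split = split_poly[OF i j ij, where f = f and n = n and a = a, folded part_1_def part_j_def]
  have eqs: "split_g i j f v = g" "split_h i j f v = h"
    using split[where z = v] f upper_part_cnj(1)[OF \<Omega> v] by (simp_all add: g_def h_def)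
  have hats: "hat (split_g i j f) v = g'" "hat (split_h i j f) v = h'"
    using split[where z = "cnj v"] f upper_part_cnj(2)[OF \<Omega> v] by (simp_all add: g'_def h'_def hat_def)
  let ?\<zeta> = "vector [g * g' + h * h', h, - g, g', h', 1] :: complex^6"
  have "?\<zeta> $ 6 \<noteq> 0 $ 6" by simp
  then have "?\<zeta> \<noteq> 0" by metis
  have form: "(\<Sum>m\<le>n. v ^ m * coord_form i j z (a m)) = z$2 * h - z$3 * g + z$4 * g' + z$5 * h'"
    unfolding coord_form_def g_def h_def g'_def h'_def
    by (simp add: sum_distrib_left sum.distrib sum_subtractf algebra_simps)
  have "(\<Sum>k\<in>UNIV. z$k * ?\<zeta>$k)
      = z$1 * (g * g' + h * h') + (\<Sum>m\<le>n. v ^ m * coord_form i j z (a m)) + z$6"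
    unfolding form by (simp add: sum_6 algebra_simps)
  moreover have "twistor i j f v \<in> hyperplane_section z \<longleftrightarrow> (\<Sum>k\<in>UNIV. z$k * ?\<zeta>$k) = 0"
    unfolding twistor_def Let_def eqs hats
    by (rule pt_in_hyperplane_section_iff[OF \<open>?\<zeta> \<noteq> 0\<close>]) simp
  ultimately show ?thesis
    by (simp only:)
qed

text \<open>
  The equation of a hyperplane, evaluated along the curve, is a polynomial in \<open>v\<close>, and it vanishes on
  the infinite set \<open>V\<close> only if all its coefficients vanish. If \<open>d\<close> is the degree of \<open>f\<close>, the
  coefficient of \<open>v\<^sup>2\<^sup>d\<close> is \<open>z\<^sub>1 \<bar>a\<^sub>d\<bar>\<^sup>2\<close>, which forces \<open>z\<^sub>1 = 0\<close>; after that the coefficient of \<open>v\<^sup>m\<close> is the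
  value at \<open>a\<^sub>m\<close> of the form with coefficients \<open>z\<^sub>2, \<dots>, z\<^sub>5\<close>.
\<close>

lemma twistor_curve_in_section_iff:
  assumes \<Omega>: "symmetric_slice_domain \<Omega>" and f: "\<forall>q\<in>\<Omega>. f q = (\<Sum>m\<le>n. q ^ m * a m)"
    and nonconst: "\<not> f constant_on \<Omega>"
  shows "twistor i j f ` upper_part i \<Omega> \<subseteq> hyperplane_section z \<longleftrightarrow>
    z$1 = 0 \<and> z$6 = - coord_form i j z (a 0) \<and> (\<forall>m\<in>{1..n}. coord_form i j z (a m) = 0)"
    (is "?L \<longleftrightarrow> ?R")
proof
  note on_curve = twistor_in_section_iff[OF \<Omega> f]
  have sum_split: "(\<Sum>m\<le>n. F m) = F 0 + (\<Sum>m\<in>{1..n}. F m)" for F :: "nat \<Rightarrow> 'b::comm_monoid_add"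
    by (simp add: atMost_atLeast0 sum.atLeast_Suc_atMost)
  {
    assume R: ?R
    have "(\<Sum>m\<le>n. v ^ m * coord_form i j z (a m)) = coord_form i j z (a 0)" for v
      using R by (simp add: sum_split)
    then show ?L
      using R by (auto simp: on_curve)
  }
  assume L: ?L
  let ?P = "\<lambda>F. \<Sum>m\<le>n. monom (F m) m :: complex poly"
  have coeff_P: "coeff (?P F) m = (if m \<le> n then F m else 0)" for F m
    by (simp add: coeff_sum coeff_monom)
  have poly_P: "poly (?P F) v = (\<Sum>m\<le>n. v ^ m * F m)" for F v
    by (simp add: poly_sum poly_monom mult.commute)
  define b c where "b m = part_1 i j (a m)" and "c m = part_j i j (a m)" for m
  define E where "E = smult (z$1) (?P b * ?P (\<lambda>m. cnj (b m)) + ?P c * ?P (\<lambda>m. cnj (c m)))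
      + ?P (\<lambda>m. coord_form i j z (a m)) + [:z$6:]"
  have "poly E v = 0" if "v \<in> upper_part i \<Omega>" for v
  proof -
    have "twistor i j f v \<in> hyperplane_section z"
      using L that by blast
    from iffD1[OF on_curve[OF that] this] show ?thesis
      unfolding E_def poly_add poly_smult poly_mult poly_P b_def c_def by simp
  qed
  then have "upper_part i \<Omega> \<subseteq> {v. poly E v = 0}"
    by (intro subsetI CollectI)
  then have "infinite {v. poly E v = 0}"
    by (rule infinite_super[OF _ infinite_upper_part[OF \<Omega>]])
  then have "E = 0"
    using poly_roots_finite[of E] by (rule contrapos_np)
  have ex: "\<exists>m. m \<le> n \<and> 1 \<le> m \<and> a m \<noteq> 0"
  proof (rule ccontr)
    assume "\<not> ?thesis"
    then have "f q = a 0" if "q \<in> \<Omega>" for q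
      using f that by (auto simp: sum_split)
    with nonconst show False
      by (auto simp: constant_on_def)
  qed
  define d where "d = Max {m. m \<le> n \<and> 1 \<le> m \<and> a m \<noteq> 0}"
  have "d \<in> {m. m \<le> n \<and> 1 \<le> m \<and> a m \<noteq> 0}"
    unfolding d_def using ex by (intro Max_in) auto
  then have d: "d \<le> n" "1 \<le> d" "a d \<noteq> 0"
    by auto
  have above: "a m = 0" if "m > d" "m \<le> n" for m
  proof (rule ccontr)
    assume "a m \<noteq> 0"
    then have "m \<le> d"
      unfolding d_def using that by (intro Max_ge) auto
    with that show False by simp
  qed
  have parts_0: "part_1 i j 0 = 0" "part_j i j 0 = 0"
    using parts_eq_0_iff[OF i j ij, of 0] by simp_all
  have "coord_form i j z (a (2 * d)) = 0" if "2 * d \<le> n"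
    using above[of "2 * d"] that d by (simp add: coord_form_def parts_0)
  moreover have "coeff [:z$6:] (2 * d) = 0"
    using d by (cases d) simp_all
  ultimately have "coeff E (2 * d) = z$1 * (b d * cnj (b d) + c d * cnj (c d))"
    using d(1) unfolding E_def coeff_add coeff_smult
    by (subst (1 2) coeff_mult_top[of d]) (auto simp: coeff_P above b_def c_def parts_0)
  moreover have "b d * cnj (b d) + c d * cnj (c d) \<noteq> 0"
  proof -
    have "b d \<noteq> 0 \<or> c d \<noteq> 0"
      using parts_eq_0_iff[OF i j ij, of "a d"] d by (auto simp: b_def c_def)
    then have "(cmod (b d))\<^sup>2 + (cmod (c d))\<^sup>2 \<noteq> 0"
      by (auto simp: add_nonneg_eq_0_iff)
    then show ?thesis
      by (simp only: complex_norm_square[symmetric] of_real_add[symmetric] of_real_eq_0_iff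
          not_False_eq_True)
  qed
  ultimately have z1: "z$1 = 0"
    using \<open>E = 0\<close> by simp
  have "coeff E m = 0" for m
    using \<open>E = 0\<close> by simp
  then have coeffs: "(if m \<le> n then coord_form i j z (a m) else 0) + coeff [:z$6:] m = 0" for m
    by (simp add: E_def z1 coeff_P)
  have "coord_form i j z (a m) = 0" if "m \<in> {1..n}" for m
    using coeffs[of m] that by (cases m) auto
  moreover have "z$6 = - coord_form i j z (a 0)"
    using coeffs[of 0] by (simp add: eq_neg_iff_add_eq_0 add.commute)
  ultimately show ?R
    using z1 by blast
qed

end

section \<open>Projectivizations\<close>

lemma bij_betw_projectivization:
  fixes \<phi> :: "'v::ab_group_add \<Rightarrow> 'w::ab_group_add"
  assumes \<phi>: "Vector_Spaces.linear s s' \<phi>"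
    and U: "module.subspace s U" and bij: "bij_betw \<phi> U A"
  shows "bij_betw (\<lambda>P. \<phi> ` P) (projectivization s U) (projectivization s' A)"
proof -
  interpret Vector_Spaces.linear s s' \<phi> by fact
  have point: "\<phi> ` hpoint s x = hpoint s' (\<phi> x)" for x
  proof
    show "\<phi> ` hpoint s x \<subseteq> hpoint s' (\<phi> x)"
      by (auto simp: hpoint_def scale)
    show "hpoint s' (\<phi> x) \<subseteq> \<phi> ` hpoint s x"
    proof
      fix p assume "p \<in> hpoint s' (\<phi> x)"
      then obtain c where "c \<noteq> 0" "p = \<phi> (s c x)"
        by (auto simp: hpoint_def scale)
      then show "p \<in> \<phi> ` hpoint s x"
        by (auto simp: hpoint_def)
    qed
  qed
  have "\<phi> ` (U - {0}) = \<phi> ` U - \<phi> ` {0}"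
    using bij_betw_imp_inj_on[OF bij] vs1.subspace_0[OF U] by (intro inj_on_image_set_diff) auto
  then have "\<phi> ` (U - {0}) = A - {0}"
    by (simp add: bij_betw_imp_surj_on[OF bij] zero)
  moreover have "P = P'"
    if "P \<in> projectivization s U" "P' \<in> projectivization s U" "\<phi> ` P = \<phi> ` P'" for P P'
  proof -
    obtain x x' where x: "x \<in> U" "P = hpoint s x" and x': "x' \<in> U" "P' = hpoint s x'"
      using \<open>P \<in> _\<close> \<open>P' \<in> _\<close> by (auto simp: projectivization_def)
    with \<open>\<phi> ` P = \<phi> ` P'\<close> have "hpoint s' (\<phi> x) = hpoint s' (\<phi> x')"
      by (simp add: point)
    then obtain c where "c \<noteq> 0" "\<phi> x' = s' c (\<phi> x)"
      using hpoint_eq_iff[OF vs2.vector_space_axioms] by blast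
    then have "\<phi> x' = \<phi> (s c x)"
      by (simp add: scale)
    then have "x' = s c x"
      using bij_betw_imp_inj_on[OF bij] x x' vs1.subspace_scale[OF U] by (auto dest: inj_onD)
    with \<open>c \<noteq> 0\<close> show ?thesis
      using hpoint_eq_iff[OF vs1.vector_space_axioms] x x' by blast
  qed
  moreover have "(\<lambda>P. \<phi> ` P) ` projectivization s U = hpoint s' ` \<phi> ` (U - {0})"
    by (simp add: projectivization_def image_image point)
  ultimately show ?thesis
    unfolding bij_betw_def inj_on_def by (simp add: projectivization_def)
qed

text \<open>
  The image of a point under \<open>h\<close> is a singleton because \<open>h\<close> ignores non-zero scalars, and
  \<^const>\<open>the_elem\<close> reads off its element.
\<close>

lemma bij_betw_projectivization_induced:
  fixes h :: "'v::ab_group_add \<Rightarrow> 'b"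
  assumes s: "vector_space s"
    and h: "\<And>x y. x \<in> A - {0} \<Longrightarrow> y \<in> A - {0} \<Longrightarrow> h x = h y \<Longrightarrow> \<exists>c. c \<noteq> 0 \<and> y = s c x"
    and const: "\<And>x c. x \<in> A - {0} \<Longrightarrow> c \<noteq> 0 \<Longrightarrow> h (s c x) = h x"
  shows "bij_betw (\<lambda>P. the_elem (h ` P)) (projectivization s A) (h ` (A - {0}))"
proof -
  have val: "the_elem (h ` hpoint s x) = h x" if "x \<in> A - {0}" for x
  proof -
    have "h ` hpoint s x = {h x}"
      unfolding hpoint_def using const[OF that] by (auto intro!: image_eqI[of _ _ "s 1 x"] exI[of _ 1])
    then show ?thesis by simp
  qed
  have inj: "hpoint s x = hpoint s y" if "x \<in> A - {0}" "y \<in> A - {0}" "h x = h y" for x y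
    unfolding hpoint_eq_iff[OF s] by (rule h[OF that])
  show ?thesis
    unfolding bij_betw_def
  proof
    show "inj_on (\<lambda>P. the_elem (h ` P)) (projectivization s A)"
    proof (rule inj_onI)
      fix P P'
      assume "P \<in> projectivization s A" "P' \<in> projectivization s A"
      then obtain x y where "x \<in> A - {0}" "P = hpoint s x" "y \<in> A - {0}" "P' = hpoint s y"
        unfolding projectivization_def by blast
      moreover assume "the_elem (h ` P) = the_elem (h ` P')"
      ultimately show "P = P'"
        using inj[of x y] val[of x] val[of y] by simp
    qed
    show "(\<lambda>P. the_elem (h ` P)) ` projectivization s A = h ` (A - {0})"
      unfolding projectivization_def image_image by (rule image_cong[OF refl]) (rule val)
  qed
qed


section \<open>Real-linear maps that vanish on a subspace\<close>

lemma subspace_annihilator: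
  "module.subspace fscale {\<Lambda>. linear \<Lambda> \<and> (\<forall>s\<in>S. \<Lambda> s = 0)}"
  for S :: "'a::real_vector set"
proof -
  interpret F: vector_space "fscale :: complex \<Rightarrow> ('a \<Rightarrow> complex) \<Rightarrow> _"
    by (rule vector_space_fscale)
  show ?thesis
  proof (rule F.subspaceI)
    show "0 \<in> {\<Lambda>. linear \<Lambda> \<and> (\<forall>s\<in>S. \<Lambda> s = (0::complex))}"
      by (auto intro: linearI)
  next
    fix \<Lambda> \<Lambda>' :: "'a \<Rightarrow> complex"
    assume "\<Lambda> \<in> {\<Lambda>. linear \<Lambda> \<and> (\<forall>s\<in>S. \<Lambda> s = 0)}" "\<Lambda>' \<in> {\<Lambda>. linear \<Lambda> \<and> (\<forall>s\<in>S. \<Lambda> s = 0)}"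
    then show "\<Lambda> + \<Lambda>' \<in> {\<Lambda>. linear \<Lambda> \<and> (\<forall>s\<in>S. \<Lambda> s = 0)}"
      by (auto intro!: linearI simp: linear_add linear_scale algebra_simps)
  next
    fix c and \<Lambda> :: "'a \<Rightarrow> complex"
    assume "\<Lambda> \<in> {\<Lambda>. linear \<Lambda> \<and> (\<forall>s\<in>S. \<Lambda> s = 0)}"
    then show "fscale c \<Lambda> \<in> {\<Lambda>. linear \<Lambda> \<and> (\<forall>s\<in>S. \<Lambda> s = 0)}"
      by (auto intro!: linearI simp: fscale_def linear_add linear_scale algebra_simps)
  qed
qed

lemma subspace_supported: "module.subspace fscale {u :: nat \<Rightarrow> complex. \<forall>k>m. u k = 0}"
proof -
  interpret F: vector_space "fscale :: complex \<Rightarrow> (nat \<Rightarrow> complex) \<Rightarrow> _"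
    by (rule vector_space_fscale)
  show ?thesis
    by (rule F.subspaceI) (auto simp: fscale_def)
qed

text \<open>
  A real-linear map that vanishes on \<open>S\<close> is determined by its values on an orthonormal basis
  \<open>e\<^sub>0, \<dots>, e\<^sub>m\<close> of the orthogonal complement of \<open>S\<close>, and these values are arbitrary complex numbers.
\<close>

lemma annihilator_parametrization:
  fixes S :: "'a::euclidean_space set"
  assumes S: "subspace S" and dim: "dim S + Suc m = DIM('a)"
  shows "\<exists>\<phi>. Vector_Spaces.linear fscale fscale \<phi> \<and>
    bij_betw \<phi> {u. \<forall>k>m. u k = 0} {\<Lambda> :: 'a \<Rightarrow> complex. linear \<Lambda> \<and> (\<forall>s\<in>S. \<Lambda> s = 0)}"
proof -
  define T where "T = {y. \<forall>x\<in>S. orthogonal x y}"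
  have T: "subspace T"
    unfolding T_def by (rule subspace_orthogonal_to_vectors)
  have "dim T = Suc m"
    using dim_subspace_orthogonal_to_vectors[OF S subspace_UNIV subset_UNIV] dim
    by (simp add: T_def)
  then obtain B where B: "B \<subseteq> T" "pairwise orthogonal B" "\<And>x. x \<in> B \<Longrightarrow> norm x = 1"
      "independent B" "card B = Suc m" "span B = T"
    using orthonormal_basis_subspace[OF T] by metis
  have fin: "finite B"
    using B(5) card.infinite by fastforce
  obtain e where e: "bij_betw e {..m} B"
    using ex_bij_betw_nat_finite[OF fin] B(5) by (auto simp: lessThan_Suc_atMost atLeast0LessThan)
  have eT: "e k \<in> T" if "k \<le> m" for k
    using e that B(1) by (auto simp: bij_betw_def)
  have ee: "e k \<bullet> e l = (if k = l then 1 else 0)" if "k \<le> m" "l \<le> m" for k l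
  proof -
    have "e k \<in> B" "e l \<in> B" "e k = e l \<longleftrightarrow> k = l"
      using e that by (auto simp: bij_betw_def inj_on_def)
    then show ?thesis
      using B(2,3) by (auto simp: pairwise_def orthogonal_def norm_eq_1)
  qed
  have expand: "\<Lambda> q = (\<Sum>k\<le>m. \<Lambda> (e k) * of_real (q \<bullet> e k))"
    if \<Lambda>: "linear \<Lambda>" "\<forall>s\<in>S. \<Lambda> s = (0::complex)" for \<Lambda> q
  proof -
    obtain y z where yz: "y \<in> span S" "\<And>w. w \<in> span S \<Longrightarrow> orthogonal z w" "q = y + z"
      using orthogonal_subspace_decomp_exists by blast
    have "y \<in> S"
      using yz(1) span_eq_iff[THEN iffD2, OF S] by simp
    have "z \<in> span B"
      using yz(2) B(6) by (auto simp: T_def orthogonal_commute intro: span_base)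
    then have "z = (\<Sum>b\<in>B. (z \<bullet> b) *\<^sub>R b)"
      using orthonormal_basis_expand[of B z] B(2,3) fin by simp
    also have "\<dots> = (\<Sum>k\<le>m. (z \<bullet> e k) *\<^sub>R e k)"
      by (rule sum.reindex_bij_betw[OF e, symmetric])
    also have "\<dots> = (\<Sum>k\<le>m. (q \<bullet> e k) *\<^sub>R e k)"
      using eT \<open>y \<in> S\<close> by (intro sum.cong) (auto simp: yz(3) inner_add_left T_def orthogonal_def)
    finally have "\<Lambda> z = \<Lambda> (\<Sum>k\<le>m. (q \<bullet> e k) *\<^sub>R e k)"
      by (rule arg_cong)
    moreover have "\<Lambda> q = \<Lambda> z"
      using \<Lambda> \<open>y \<in> S\<close> by (simp add: yz(3) linear_add)
    ultimately show ?thesis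
      using \<Lambda>(1) by (simp add: linear_sum linear_scale scaleR_conv_of_real mult.commute)
  qed
  define \<phi> where "\<phi> u q = (\<Sum>k\<le>m. u k * of_real (q \<bullet> e k))" for u :: "nat \<Rightarrow> complex" and q
  have \<phi>_e: "\<phi> u (e l) = u l" if "l \<le> m" for u l
  proof -
    have "\<phi> u (e l) = (\<Sum>k\<le>m. if k = l then u l else 0)"
      unfolding \<phi>_def using ee that by (intro sum.cong) auto
    with that show ?thesis by simp
  qed
  have "bij_betw \<phi> {u. \<forall>k>m. u k = 0} {\<Lambda>. linear \<Lambda> \<and> (\<forall>s\<in>S. \<Lambda> s = 0)}"
    unfolding bij_betw_def
  proof (intro conjI subset_antisym subsetI)
    show "inj_on \<phi> {u. \<forall>k>m. u k = 0}"
    proof (intro inj_onI ext)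
      fix u u' k
      assume "u \<in> {u. \<forall>k>m. u k = 0}" "u' \<in> {u. \<forall>k>m. u k = 0}" "\<phi> u = \<phi> u'"
      then show "u k = u' k"
        using \<phi>_e[of k u] \<phi>_e[of k u'] by (cases "k \<le> m") auto
    qed
  next
    fix \<Lambda> assume "\<Lambda> \<in> \<phi> ` {u. \<forall>k>m. u k = 0}"
    then obtain u where \<Lambda>: "\<Lambda> = \<phi> u" by blast
    have "linear \<Lambda>"
      unfolding \<Lambda> \<phi>_def
      by (rule linearI)
        (simp_all add: inner_add_left algebra_simps sum.distrib sum_distrib_left scaleR_conv_of_real)
    moreover have "\<Lambda> s = 0" if "s \<in> S" for s
      using eT that unfolding \<Lambda> \<phi>_def by (intro sum.neutral) (auto simp: T_def orthogonal_def)
    ultimately show "\<Lambda> \<in> {\<Lambda>. linear \<Lambda> \<and> (\<forall>s\<in>S. \<Lambda> s = 0)}" by simp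
  next
    fix \<Lambda> :: "'a \<Rightarrow> complex" assume "\<Lambda> \<in> {\<Lambda>. linear \<Lambda> \<and> (\<forall>s\<in>S. \<Lambda> s = 0)}"
    then have "\<Lambda> = \<phi> (\<lambda>k. if k \<le> m then \<Lambda> (e k) else 0)"
      using expand unfolding \<phi>_def by (auto simp: fun_eq_iff)
    moreover have "(\<lambda>k. if k \<le> m then \<Lambda> (e k) else 0) \<in> {u. \<forall>k>m. u k = 0}"
      by simp
    ultimately show "\<Lambda> \<in> \<phi> ` {u. \<forall>k>m. u k = 0}"
      by (rule image_eqI[of \<Lambda> \<phi>])
  qed
  moreover have "Vector_Spaces.linear fscale fscale \<phi>"
    unfolding Vector_Spaces.linear_iff
    by (simp add: vector_space_fscale \<phi>_def fun_eq_iff fscale_def algebra_simps sum.distrib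
        sum_distrib_left)
  ultimately show ?thesis by blast
qed

section \<open>Orbits of PGL(2,H) on the dual projective space\<close>

lemma vector_4:
  "(vector [x1, x2, x3, x4] :: ('a::zero)^4) $ 1 = x1"
  "(vector [x1, x2, x3, x4] :: ('a::zero)^4) $ 2 = x2"
  "(vector [x1, x2, x3, x4] :: ('a::zero)^4) $ 3 = x3"
  "(vector [x1, x2, x3, x4] :: ('a::zero)^4) $ 4 = x4"
  unfolding vector_def by simp_all

lemma ext_square_expand:
  "ext_square T \<zeta> =
     \<zeta>$1 *s wedge (column 3 T) (column 4 T) - \<zeta>$2 *s wedge (column 2 T) (column 4 T)
   + \<zeta>$3 *s wedge (column 2 T) (column 3 T) + \<zeta>$4 *s wedge (column 1 T) (column 4 T)
   - \<zeta>$5 *s wedge (column 1 T) (column 3 T) + \<zeta>$6 *s wedge (column 1 T) (column 2 T)"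
proof -
  have col: "T *v axis k 1 = column k T" for k
    by (simp add: column_def matrix_vector_mult_def axis_def if_distrib cong: if_cong)
  show ?thesis
    unfolding ext_square_def Let_def col by (simp add: vec_eq_iff)
qed

lemma ext_square_scale:
  "ext_square (r *\<^sub>R T) (d *s \<zeta>) = (of_real (r\<^sup>2) * d) *s ext_square T \<zeta>"
proof (rule vec6_eqI)
  have col: "column k (r *\<^sub>R T) $ m = of_real r * column k T $ m" for k m
    by (simp add: column_def scaleR_conv_of_real[of r "T$m$k"])
  show "ext_square (r *\<^sub>R T) (d *s \<zeta>) $ 1 = ((of_real (r\<^sup>2) * d) *s ext_square T \<zeta>) $ 1"
    "ext_square (r *\<^sub>R T) (d *s \<zeta>) $ 2 = ((of_real (r\<^sup>2) * d) *s ext_square T \<zeta>) $ 2"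
    "ext_square (r *\<^sub>R T) (d *s \<zeta>) $ 3 = ((of_real (r\<^sup>2) * d) *s ext_square T \<zeta>) $ 3"
    "ext_square (r *\<^sub>R T) (d *s \<zeta>) $ 4 = ((of_real (r\<^sup>2) * d) *s ext_square T \<zeta>) $ 4"
    "ext_square (r *\<^sub>R T) (d *s \<zeta>) $ 5 = ((of_real (r\<^sup>2) * d) *s ext_square T \<zeta>) $ 5"
    "ext_square (r *\<^sub>R T) (d *s \<zeta>) $ 6 = ((of_real (r\<^sup>2) * d) *s ext_square T \<zeta>) $ 6"
    unfolding ext_square_expand vector_add_component vector_minus_component vector_smult_component
      wedge_nth col of_real_power
    by algebra+
qed

text \<open>
  The right-hand side is the preimage of \<open>z\<close> under \<^const>\<open>kappa\<close>. Rescaling \<open>T\<close> by a real number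
  multiplies \<open>\<Lambda>\<^sup>2 T\<close> by a square, so the image of the point does not depend on the representative.
\<close>

lemma kappa_orbit_memI:
  fixes z \<zeta> :: "complex^6"
  assumes T: "T \<in> GL2H" and c: "c \<noteq> 0"
    and eq: "ext_square T \<zeta> = c *s vector [z$6, - z$5, z$4, z$3, - z$2, z$1]"
  shows "pt z \<in> kappa ` PGL2H_orbit (pt \<zeta>)"
proof -
  let ?w = "vector [z$6, - z$5, z$4, z$3, - z$2, z$1] :: complex^6"
  define C where "C = {r *\<^sub>R T |r. r \<noteq> 0}"
  have "C \<in> PGL2H"
    using T by (auto simp: PGL2H_def C_def)
  have act: "PGL2H_act C (pt \<zeta>) = pt ?w"
  proof
    show "PGL2H_act C (pt \<zeta>) \<subseteq> pt ?w"
    proof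
      fix p assume "p \<in> PGL2H_act C (pt \<zeta>)"
      then obtain r d where "r \<noteq> 0" "d \<noteq> 0" "p = ext_square (r *\<^sub>R T) (d *s \<zeta>)"
        by (auto simp: PGL2H_act_def C_def hpoint_def)
      then have "of_real (r\<^sup>2) * d * c \<noteq> 0" "p = (of_real (r\<^sup>2) * d * c) *s ?w"
        using c by (simp_all add: ext_square_scale eq)
      then show "p \<in> pt ?w"
        unfolding hpoint_def by blast
    qed
    show "pt ?w \<subseteq> PGL2H_act C (pt \<zeta>)"
    proof
      fix p assume "p \<in> pt ?w"
      then obtain d where d: "d \<noteq> 0" "p = d *s ?w"
        by (auto simp: hpoint_def)
      then have "p = ext_square (1 *\<^sub>R T) ((d / c) *s \<zeta>)"
        using c unfolding ext_square_scale by (simp add: eq)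
      moreover have "1 *\<^sub>R T \<in> C"
        unfolding C_def by (intro CollectI exI[of _ 1]) simp
      moreover have "(d / c) *s \<zeta> \<in> pt \<zeta>"
        unfolding hpoint_def using c d by (intro CollectI exI[of _ "d / c"]) simp
      ultimately show "p \<in> PGL2H_act C (pt \<zeta>)"
        unfolding PGL2H_act_def by blast
    qed
  qed
  have \<kappa>: "vector [(d *s ?w)$6, - (d *s ?w)$5, (d *s ?w)$4, (d *s ?w)$3, - (d *s ?w)$2, (d *s ?w)$1]
      = d *s z" for d
    by (rule vec6_eqI) simp_all
  have "kappa (pt ?w) = {d *s z |d. d \<noteq> 0}"
  proof
    show "kappa (pt ?w) \<subseteq> {d *s z |d. d \<noteq> 0}"
    proof
      fix p assume "p \<in> kappa (pt ?w)"
      then obtain d where "d \<noteq> 0"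
        "p = vector [(d *s ?w)$6, - (d *s ?w)$5, (d *s ?w)$4, (d *s ?w)$3, - (d *s ?w)$2, (d *s ?w)$1]"
        unfolding kappa_def hpoint_def by blast
      then show "p \<in> {d *s z |d. d \<noteq> 0}"
        unfolding \<kappa> by blast
    qed
    show "{d *s z |d. d \<noteq> 0} \<subseteq> kappa (pt ?w)"
    proof
      fix p assume "p \<in> {d *s z |d. d \<noteq> 0}"
      then obtain d where "d \<noteq> 0" "p = d *s z"
        by blast
      then have "p = vector [(d *s ?w)$6, - (d *s ?w)$5, (d *s ?w)$4, (d *s ?w)$3, - (d *s ?w)$2, (d *s ?w)$1]"
        "d *s ?w \<in> pt ?w"
        unfolding \<kappa> hpoint_def by blast+
      then show "p \<in> kappa (pt ?w)"
        unfolding kappa_def by (rule image_eqI)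
    qed
  qed
  then have "kappa (pt ?w) = pt z"
    by (simp add: hpoint_def)
  then have "kappa (PGL2H_act C (pt \<zeta>)) = pt z"
    by (simp only: act)
  then show ?thesis
    unfolding PGL2H_orbit_def using \<open>C \<in> PGL2H\<close> by blast
qed

text \<open>
  One family of base points for all three types: \<open>l = 1\<close> gives \<^const>\<open>A_QN\<close>, \<open>0 < l < 1\<close> gives
  \<^const>\<open>A_nd\<close>, and \<open>l = 0\<close> gives the base point of \<^const>\<open>A_minus\<close> up to the factor \<open>- 1\<close>.
\<close>

definition normal_point :: "real \<Rightarrow> complex^6" where
  "normal_point l = vector [- 1, 0, - \<i> * of_real l, \<i> * of_real l, 0, 1]"

text \<open>
  Let \<open>J\<close> be the antilinear map of \<open>\<complex>\<^sup>4\<close> with \<open>J e\<^sub>1 = e\<^sub>2\<close>, \<open>J e\<^sub>2 = - e\<^sub>1\<close>, \<open>J e\<^sub>3 = e\<^sub>4\<close>,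
  \<open>J e\<^sub>4 = - e\<^sub>3\<close>. The elements of \<open>GL(2,H)\<close> commute with \<open>J\<close>, that is, they have columns
  \<open>u, J u, v, J v\<close>. With \<open>\<lambda> = l\<close>, such an element carries the normal point to
  \<open>u \<and> J u - v \<and> J v + \<i> \<lambda> (u \<and> J v + v \<and> J u)\<close>, the counterpart of the complexified hermitian matrix
  \<open>u u\<^sup>* - v v\<^sup>* + \<i> \<lambda> (u v\<^sup>* + v u\<^sup>*)\<close> over the quaternions. Let \<open>\<alpha>\<close> be the quaternion whose block has
  the first row \<open>(y, - x)\<close>, and \<open>k\<close> the one whose block has the first column \<open>(s, t)\<close>; the hypotheses
  on \<open>s\<close> and \<open>t\<close> say that \<open>k\<close> is an imaginary unit.
  For \<open>u = (1, \<alpha>\<^sup>*/2)\<close> and \<open>v = (k, - \<alpha>\<^sup>* k/2)\<close> the diagonal of this matrix vanishes, and its upper right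
  entry is \<open>\<alpha> + \<i> \<lambda> k \<alpha>\<close>. Finally a shear by \<open>p + q j\<close>, which adds the multiple of the upper half of a
  vector by \<open>p + q j\<close> to its lower half, affects the first coordinate only: the form with coefficients
  \<open>z\<^sub>2, \<dots>, z\<^sub>5\<close>, evaluated at \<open>p + q j\<close>, is subtracted from it.
\<close>

lemma normal_point_orbit:
  fixes x y p q s t :: complex and l :: real
  assumes xy: "x \<noteq> 0 \<or> y \<noteq> 0" and s: "cnj s = - s" and st: "s * cnj s + t * cnj t = 1"
  defines "\<xi> \<equiv> s * x + cnj t * cnj y" and "\<eta> \<equiv> s * y - cnj t * cnj x"
  defines "z2 \<equiv> x + \<i> * of_real l * \<xi>" and "z3 \<equiv> y + \<i> * of_real l * \<eta>"
    and "z4 \<equiv> - cnj y - \<i> * of_real l * cnj \<eta>" and "z5 \<equiv> cnj x + \<i> * of_real l * cnj \<xi>"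
  shows "\<exists>T\<in>GL2H. ext_square T (normal_point l)
    = vector [- (z2 * q - z3 * p + z4 * cnj p + z5 * cnj q), - z5, z4, z3, - z2, 0]"
proof -
  define X Y where "X = x / 2" and "Y = y / 2"
  then have x: "x = 2 * X" and y: "y = 2 * Y"
    by (simp_all add: mult.commute)
  \<comment> \<open>The lower halves of \<open>u\<close> and \<open>v\<close>, with the shear by \<open>p + q j\<close> included.\<close>
  define u3 u4 v3 v4 where "u3 = p + cnj Y" and "u4 = q - cnj X"
    and "v3 = (p - cnj Y) * s - (cnj q + X) * t" and "v4 = (q + cnj X) * s + (cnj p - Y) * t"
  define T :: "complex^4^4" where "T = vector
     [vector [1, 0, s, - cnj t], vector [0, 1, t, cnj s],
      vector [u3, - cnj u4, v3, - cnj v4], vector [u4, cnj u3, v4, cnj v3]]"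
  have col: "column 1 T = vector [1, 0, u3, u4]" "column 2 T = vector [0, 1, - cnj u4, cnj u3]"
    "column 3 T = vector [s, t, v3, v4]" "column 4 T = vector [- cnj t, cnj s, - cnj v4, cnj v3]"
    by (simp_all add: T_def column_def vec_eq_iff forall_4 vector_4)
  have "x' = 0" if Tx: "T *v x' = 0" for x'
  proof -
    have rows: "(T *v x') $ k = T$k$1 * x'$1 + T$k$2 * x'$2 + T$k$3 * x'$3 + T$k$4 * x'$4" for k
      by (simp add: matrix_vector_mult_def sum_4)
    \<comment> \<open>The upper two rows say that the first quaternion of \<open>x'\<close> is \<open>- w\<close>, where \<open>w\<close> is \<open>k\<close> times the
      second one. The shear then cancels from the lower two rows, which reduce to \<open>\<alpha>\<^sup>* w = 0\<close>.\<close>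
    define w1 w2 where "w1 = s * x'$3 - cnj t * x'$4" and "w2 = t * x'$3 + cnj s * x'$4"
    have r1: "x'$1 + s * x'$3 - cnj t * x'$4 = 0" and r2: "x'$2 + t * x'$3 + cnj s * x'$4 = 0"
      and r3: "u3 * x'$1 - cnj u4 * x'$2 + v3 * x'$3 - cnj v4 * x'$4 = 0"
      and r4: "u4 * x'$1 + cnj u3 * x'$2 + v4 * x'$3 + cnj v3 * x'$4 = 0"
      using rows[of 1] rows[of 2] rows[of 3] rows[of 4] Tx by (simp_all add: T_def vector_4)
    have x1: "x'$1 = - w1" and x2: "x'$2 = - w2"
      using r1 r2 by (simp_all add: w1_def w2_def) algebra+
    have "2 * (cnj Y * w1 + X * w2) = 0" and "2 * (cnj X * w1 - Y * w2) = 0"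
      using r3 r4 unfolding x1 x2 w1_def w2_def u3_def u4_def v3_def v4_def
      by (simp_all add: s) algebra+
    then have "cnj Y * w1 + X * w2 = 0" and "cnj X * w1 - Y * w2 = 0"
      unfolding mult_eq_0_iff by simp_all
    then have "(x * cnj x + y * cnj y) * w1 = 0" "(x * cnj x + y * cnj y) * w2 = 0"
      unfolding x y complex_cnj_mult complex_cnj_numeral by algebra+
    moreover have "x * cnj x + y * cnj y \<noteq> 0"
    proof -
      have "(cmod x)\<^sup>2 + (cmod y)\<^sup>2 \<noteq> 0"
        using xy by (auto simp: add_nonneg_eq_0_iff)
      then show ?thesis
        by (simp only: complex_norm_square[symmetric] of_real_add[symmetric] of_real_eq_0_iff
            not_False_eq_True)
    qed
    ultimately have w: "w1 = 0" "w2 = 0"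
      by simp_all
    have "x'$3 = 0" "x'$4 = 0"
      using w st unfolding w1_def w2_def by algebra+
    then show "x' = 0"
      using x1 x2 w by (simp add: vec_eq_iff forall_4)
  qed
  then have "invertible T"
    unfolding invertible_left_inverse matrix_left_invertible_ker by blast
  then have "T \<in> GL2H"
    by (auto simp: GL2H_def quat_block_def T_def vector_4)
  moreover have "ext_square T (normal_point l)
    = vector [- (z2 * q - z3 * p + z4 * cnj p + z5 * cnj q), - z5, z4, z3, - z2, 0]"
  proof -
    define L where "L = \<i> * of_real l"
    have st': "t * cnj t - s * s = 1"
      using st by (simp add: s)
    have expand: "ext_square T (normal_point l) $ k = wedge (column 1 T) (column 2 T) $ k
        - wedge (column 3 T) (column 4 T) $ k
        + L * (wedge (column 1 T) (column 4 T) $ k - wedge (column 2 T) (column 3 T) $ k)" for k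
      by (simp add: ext_square_expand normal_point_def L_def algebra_simps)
    have cnjs: "cnj u3 = cnj p + Y" "cnj u4 = cnj q - X"
      "cnj v3 = - (cnj p - Y) * s - (q + cnj X) * cnj t"
      "cnj v4 = - (cnj q + X) * s + (p - cnj Y) * cnj t"
      by (simp_all add: u3_def u4_def v3_def v4_def s algebra_simps)
    have \<xi>: "\<xi> = 2 * (s * X + cnj t * cnj Y)" and \<eta>: "\<eta> = 2 * (s * Y - cnj t * cnj X)"
      by (simp_all add: \<xi>_def \<eta>_def x y algebra_simps)
    have \<xi>': "cnj \<xi> = 2 * (- s * cnj X + t * Y)" and \<eta>': "cnj \<eta> = 2 * (- s * cnj Y - t * X)"
      by (simp_all add: \<xi> \<eta> s)
    have zs: "z2 = 2 * X + L * \<xi>" "z3 = 2 * Y + L * \<eta>"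
      "z4 = - (2 * cnj Y) - L * cnj \<eta>" "z5 = 2 * cnj X + L * cnj \<xi>"
      by (simp_all add: z2_def z3_def z4_def z5_def L_def x y)
    show ?thesis
      by (rule vec6_eqI, unfold expand wedge_nth col vector_4 vector_6 zs \<xi>' \<eta>',
          unfold \<xi> \<eta> cnjs s, unfold u3_def u4_def v3_def v4_def) (use st' in algebra)+
  qed
  ultimately show ?thesis by blast
qed

text \<open>
  The pair \<open>(x, y)\<close> holds the coordinates of a quaternion \<open>\<alpha>\<close>, and \<open>(s, t)\<close> those of \<open>k = \<beta> \<alpha>\<^sup>-\<^sup>1 / \<lambda>\<close>, where the
  form is \<open>\<alpha> + \<i> \<beta>\<close> after multiplication by \<open>c\<close> and \<open>\<lambda> = \<bar>\<beta>\<bar> / \<bar>\<alpha>\<bar>\<close>. The number \<open>c\<close> is chosen such that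
  \<open>c\<^sup>2 (z\<^sub>2 z\<^sub>5 - z\<^sub>3 z\<^sub>4) = \<bar>\<alpha>\<bar>\<^sup>2 - \<bar>\<beta>\<bar>\<^sup>2 + 2 \<i> \<langle>\<alpha>, \<beta>\<rangle>\<close> is real and non-negative: then \<open>\<alpha> \<bottom> \<beta>\<close> makes \<open>k\<close>
  imaginary, and \<open>\<bar>\<beta>\<bar> \<le> \<bar>\<alpha>\<bar>\<close> gives \<open>\<lambda> \<le> 1\<close>.
\<close>

lemma linear_form_normal_form:
  fixes z2 z3 z4 z5 :: complex
  assumes z: "(z2, z3, z4, z5) \<noteq> (0, 0, 0, 0)"
  shows "\<exists>c l x y s t. c \<noteq> 0 \<and> 0 \<le> l \<and> l \<le> 1 \<and> (x \<noteq> 0 \<or> y \<noteq> 0) \<and>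
    cnj s = - s \<and> s * cnj s + t * cnj t = 1 \<and>
    c * z2 = x + \<i> * of_real l * (s * x + cnj t * cnj y) \<and>
    c * z3 = y + \<i> * of_real l * (s * y - cnj t * cnj x) \<and>
    c * z4 = - cnj y - \<i> * of_real l * cnj (s * y - cnj t * cnj x) \<and>
    c * z5 = cnj x + \<i> * of_real l * cnj (s * x + cnj t * cnj y)"
proof -
  define D where "D = z2 * z5 - z3 * z4"
  define c where "c = (if D = 0 then 1 else csqrt (cnj D))"
  have "c \<noteq> 0"
    by (simp add: c_def)
  define d where "d = (cmod D)\<^sup>2"
  have "c * c * D = of_real d"
  proof (cases "D = 0")
    case False
    have "csqrt (cnj D) * csqrt (cnj D) = cnj D"
      by (metis power2_csqrt power2_eq_square)
    with False show ?thesis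
      unfolding d_def c_def complex_norm_square by (simp add: mult.commute)
  qed (simp add: d_def)
  define u2 u3 u4 u5 where "u2 = c * z2" and "u3 = c * z3" and "u4 = c * z4" and "u5 = c * z5"
  have uD: "u2 * u5 - u3 * u4 = of_real d"
    unfolding \<open>c * c * D = of_real d\<close>[symmetric] D_def u2_def u3_def u4_def u5_def
    by (simp add: algebra_simps)
  \<comment> \<open>A form is real-valued if and only if \<open>u\<^sub>5 = cnj u\<^sub>2\<close> and \<open>u\<^sub>4 = - cnj u\<^sub>3\<close>; hence these are the
    coordinates of its real part \<open>\<alpha>\<close> and its imaginary part \<open>\<beta>\<close>.\<close>
  define x y where "x = (u2 + cnj u5) / 2" and "y = (u3 - cnj u4) / 2"
  define \<xi> \<eta> where "\<xi> = (u2 - cnj u5) / (2 * \<i>)" and "\<eta> = (u3 + cnj u4) / (2 * \<i>)"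
  have u: "u2 = x + \<i> * \<xi>" "u3 = y + \<i> * \<eta>" "u4 = - cnj y - \<i> * cnj \<eta>" "u5 = cnj x + \<i> * cnj \<xi>"
    by (simp_all add: x_def y_def \<xi>_def \<eta>_def field_simps)
  define N M where "N = (cmod x)\<^sup>2 + (cmod y)\<^sup>2" and "M = (cmod \<xi>)\<^sup>2 + (cmod \<eta>)\<^sup>2"
  have N: "of_real N = x * cnj x + y * cnj y" and M: "of_real M = \<xi> * cnj \<xi> + \<eta> * cnj \<eta>"
    by (simp_all only: N_def M_def of_real_add complex_norm_square)
  define k where "k = 2 * Re (x * cnj \<xi> + y * cnj \<eta>)"
  have k: "of_real k = x * cnj \<xi> + cnj x * \<xi> + y * cnj \<eta> + cnj y * \<eta>"
    by (simp add: k_def complex_eq_iff)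
  have "of_real d = of_real N - of_real M + \<i> * of_real k"
    unfolding uD[symmetric] u N M k by (simp add: algebra_simps)
  then have "Re (of_real d) = Re (of_real N - of_real M + \<i> * of_real k)"
    and "Im (of_real d) = Im (of_real N - of_real M + \<i> * of_real k)"
    by simp_all
  then have dNM: "d = N - M" and "k = 0"
    by simp_all
  have "N \<ge> 0" "M \<ge> 0" "d \<ge> 0"
    by (simp_all add: N_def M_def d_def)
  have xy: "x \<noteq> 0 \<or> y \<noteq> 0"
  proof (rule ccontr)
    assume "\<not> (x \<noteq> 0 \<or> y \<noteq> 0)"
    then have "x = 0" "y = 0" by simp_all
    then have "M = 0"
      using dNM \<open>M \<ge> 0\<close> \<open>d \<ge> 0\<close> by (simp add: N_def)
    then have "\<xi> = 0" "\<eta> = 0"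
      by (simp_all add: M_def add_nonneg_eq_0_iff)
    with \<open>x = 0\<close> \<open>y = 0\<close> u have "u2 = 0" "u3 = 0" "u4 = 0" "u5 = 0"
      by simp_all
    with z \<open>c \<noteq> 0\<close> show False
      by (simp add: u2_def u3_def u4_def u5_def)
  qed
  then have "N \<noteq> 0"
    by (auto simp: N_def add_nonneg_eq_0_iff)
  with \<open>N \<ge> 0\<close> have "N > 0" by simp
  define l where "l = sqrt (M / N)"
  have l: "0 \<le> l" "l \<le> 1" "l * l * N = M"
    using \<open>N > 0\<close> \<open>M \<ge> 0\<close> dNM \<open>d \<ge> 0\<close> by (simp_all add: l_def)
  have "\<exists>s t. cnj s = - s \<and> s * cnj s + t * cnj t = 1 \<and>
    of_real l * (s * x + cnj t * cnj y) = \<xi> \<and> of_real l * (s * y - cnj t * cnj x) = \<eta>"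
    \<comment> \<open>If \<open>\<beta> = 0\<close> then \<open>\<lambda> = 0\<close>, and every imaginary unit serves as \<open>k\<close>.\<close>
  proof (cases "M = 0")
    case True
    then have "\<xi> = 0" "\<eta> = 0" "l = 0"
      by (simp_all add: M_def add_nonneg_eq_0_iff l_def)
    then show ?thesis
      by (intro exI[of _ \<i>] exI[of _ 0]) simp
  next
    case False
    then have "l \<noteq> 0"
      using l(3) by auto
    define \<rho> :: complex where "\<rho> = of_real (l * N)"
    have \<rho>: "\<rho> \<noteq> 0" "cnj \<rho> = \<rho>"
      using \<open>l \<noteq> 0\<close> \<open>N \<noteq> 0\<close> by (simp_all add: \<rho>_def)
    define s t where "s = (\<xi> * cnj x + \<eta> * cnj y) / \<rho>" and "t = (cnj \<xi> * cnj y - cnj \<eta> * cnj x) / \<rho>"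
    have st: "\<rho> * s = \<xi> * cnj x + \<eta> * cnj y" "\<rho> * t = cnj \<xi> * cnj y - cnj \<eta> * cnj x"
      using \<rho> by (simp_all add: s_def t_def)
    have st': "\<rho> * cnj s = cnj \<xi> * x + cnj \<eta> * y" "\<rho> * cnj t = \<xi> * y - \<eta> * x"
      using \<rho> by (simp_all add: s_def t_def)
    have "\<rho> * (cnj s + s) = 0"
      unfolding distrib_left st st' using k \<open>k = 0\<close> by (simp add: algebra_simps)
    then have "cnj s = - s"
      using \<rho>(1) by (simp add: eq_neg_iff_add_eq_0)
    moreover have "s * cnj s + t * cnj t = 1"
    proof -
      have "\<rho> * \<rho> * (s * cnj s + t * cnj t) = of_real N * of_real M"
        unfolding N M using st st' by algebra
      also have "\<dots> = \<rho> * \<rho> * 1"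
        unfolding \<rho>_def l(3)[symmetric] by simp
      finally show ?thesis
        using \<rho>(1) by simp
    qed
    moreover have "of_real l * (s * x + cnj t * cnj y) = \<xi>"
    proof -
      have "\<rho> * (s * x + cnj t * cnj y) = of_real N * \<xi>"
        unfolding N using st st' by algebra
      then show ?thesis
        using \<open>N \<noteq> 0\<close> by (simp add: \<rho>_def)
    qed
    moreover have "of_real l * (s * y - cnj t * cnj x) = \<eta>"
    proof -
      have "\<rho> * (s * y - cnj t * cnj x) = of_real N * \<eta>"
        unfolding N using st st' by algebra
      then show ?thesis
        using \<open>N \<noteq> 0\<close> by (simp add: \<rho>_def)
    qed
    ultimately show ?thesis by blast
  qed
  then obtain s t where st: "cnj s = - s" "s * cnj s + t * cnj t = 1"
    and \<xi>: "of_real l * (s * x + cnj t * cnj y) = \<xi>" and \<eta>: "of_real l * (s * y - cnj t * cnj x) = \<eta>"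
    by blast
  have \<xi>': "of_real l * cnj (s * x + cnj t * cnj y) = cnj \<xi>"
    and \<eta>': "of_real l * cnj (s * y - cnj t * cnj x) = cnj \<eta>"
    unfolding \<xi>[symmetric] \<eta>[symmetric] by simp_all
  show ?thesis
    by (rule exI[of _ c], rule exI[of _ l], rule exI[of _ x], rule exI[of _ y], rule exI[of _ s],
        rule exI[of _ t], unfold mult.assoc[of \<i>] \<xi> \<eta> \<xi>' \<eta>')
      (use \<open>c \<noteq> 0\<close> l xy st u in \<open>simp add: u2_def u3_def u4_def u5_def\<close>)
qed

context
  fixes i j :: quat
  assumes i: "i \<in> imag_units" and j: "j \<in> imag_units" and ij: "i * j = - (j * i)"
begin

text \<open>
  In the normal form \<open>c \<Lambda> = \<alpha> + \<i> \<lambda> k \<alpha>\<close> the real and the imaginary part are orthogonal and \<open>\<alpha> \<noteq> 0\<close>.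
  Hence \<open>\<Lambda>\<close> has rank 1 for \<open>\<lambda> = 0\<close> and rank 2 otherwise, and \<open>c\<^sup>2 \<Delta> = - \<bar>\<alpha>\<bar>\<^sup>2 (1 - \<lambda>\<^sup>2)\<close>. The shear by \<open>a\<^sub>0\<close>
  produces the coordinate \<open>z\<^sub>6 = - \<Lambda>(a\<^sub>0)\<close>.
\<close>

lemma coord_form_orbit:
  fixes z :: "complex^6"
  assumes z: "z$1 = 0" "z$6 = - coord_form i j z a0" "coord_form i j z \<noteq> 0"
  shows "\<exists>l. 0 \<le> l \<and> l \<le> 1 \<and> pt z \<in> kappa ` PGL2H_orbit (pt (normal_point l)) \<and>
    (lin_rank (coord_form i j z) = 1 \<longrightarrow> l = 0) \<and> (lin_rank (coord_form i j z) = 2 \<longrightarrow> l \<noteq> 0) \<and>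
    (z$3 * z$4 - z$2 * z$5 = 0 \<longleftrightarrow> l = 1)"
proof -
  let ?\<Lambda> = "coord_form i j z"
  have "(z$2, z$3, z$4, z$5) \<noteq> (0, 0, 0, 0)"
    using z(3) by (auto simp: coord_form_def fun_eq_iff)
  from linear_form_normal_form[OF this]
  obtain c l x y s t where c: "c \<noteq> 0" and l: "0 \<le> l" "l \<le> 1" and xy: "x \<noteq> 0 \<or> y \<noteq> 0"
    and s: "cnj s = - s" and st: "s * cnj s + t * cnj t = 1"
    and eqs: "c * z$2 = x + \<i> * of_real l * (s * x + cnj t * cnj y)"
      "c * z$3 = y + \<i> * of_real l * (s * y - cnj t * cnj x)"
      "c * z$4 = - cnj y - \<i> * of_real l * cnj (s * y - cnj t * cnj x)"
      "c * z$5 = cnj x + \<i> * of_real l * cnj (s * x + cnj t * cnj y)"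
    by (elim exE conjE) (rule that)
  obtain T where T: "T \<in> GL2H"
    and "ext_square T (normal_point l) = vector
      [- (c * z$2 * part_j i j a0 - c * z$3 * part_1 i j a0
          + c * z$4 * cnj (part_1 i j a0) + c * z$5 * cnj (part_j i j a0)),
       - (c * z$5), c * z$4, c * z$3, - (c * z$2), 0]"
    using normal_point_orbit[OF xy s st, of l "part_j i j a0" "part_1 i j a0", folded eqs] by blast
  then have "ext_square T (normal_point l) = c *s vector [z$6, - z$5, z$4, z$3, - z$2, z$1]"
    by (intro vec6_eqI) (simp_all add: z coord_form_def algebra_simps)
  with T c have orbit: "pt z \<in> kappa ` PGL2H_orbit (pt (normal_point l))"
    by (intro kappa_orbit_memI)

  define N where "N = (cmod x)\<^sup>2 + (cmod y)\<^sup>2"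
  have "N \<noteq> 0"
    using xy by (auto simp: N_def add_nonneg_eq_0_iff)
  have N: "of_real N = x * cnj x + y * cnj y"
    by (simp only: N_def of_real_add complex_norm_square)
  have st': "t * cnj t - s * s = 1"
    using st by (simp add: s)

  define \<xi> \<eta> where "\<xi> = s * x + cnj t * cnj y" and "\<eta> = s * y - cnj t * cnj x"
  have cnjs: "cnj \<xi> = - s * cnj x + t * y" "cnj \<eta> = - s * cnj y - t * x"
    by (simp_all add: \<xi>_def \<eta>_def s)
  define L where "L = \<i> * of_real l"
  note eqs = eqs[folded \<xi>_def \<eta>_def L_def]
  have form: "c * ?\<Lambda> (emb i p + emb i q * j)
      = c * z$2 * q - c * z$3 * p + c * z$4 * cnj p + c * z$5 * cnj q" for p q
    by (simp add: coord_form_emb[OF i j ij] algebra_simps)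
  have disc: "c * c * (z$3 * z$4 - z$2 * z$5) = - of_real N * (1 + L * L)"
  proof -
    have "c * c * (z$3 * z$4 - z$2 * z$5) = (c * z$3) * (c * z$4) - (c * z$2) * (c * z$5)"
      by (simp add: algebra_simps)
    also have "\<dots> = - of_real N * (1 + L * L)"
      unfolding eqs N cnjs unfolding \<xi>_def \<eta>_def using st' by algebra
    finally show ?thesis .
  qed
  have "z$3 * z$4 - z$2 * z$5 = 0 \<longleftrightarrow> 1 + L * L = 0"
    using disc c \<open>N \<noteq> 0\<close> by (metis mult_eq_0_iff neg_equal_0_iff_equal of_real_eq_0_iff)
  also have "1 + L * L = of_real (1 - l * l)"
    by (simp add: L_def complex_eq_iff)
  also have "of_real (1 - l * l) = (0::complex) \<longleftrightarrow> l * l = 1"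
    by (simp only: of_real_eq_0_iff) auto
  also have "\<dots> \<longleftrightarrow> l = 1"
    using l by (simp add: square_eq_1_iff)
  finally have disc_iff: "z$3 * z$4 - z$2 * z$5 = 0 \<longleftrightarrow> l = 1" .

  have rank_0: "lin_rank ?\<Lambda> \<noteq> 2" if "l = 0"
  proof -
    have "Im (c * ?\<Lambda> (emb i p + emb i q * j)) = 0" for p q
      unfolding form eqs using that by (simp add: L_def)
    then have im: "Im (c * ?\<Lambda> p) = 0" for p
      by (metis parts_decomp[OF i j ij])
    have "?\<Lambda> p \<in> span {inverse c}" for p
    proof -
      have "c * ?\<Lambda> p = of_real (Re (c * ?\<Lambda> p))"
        using im[of p] by (simp add: complex_eq_iff)
      then have "?\<Lambda> p = of_real (Re (c * ?\<Lambda> p)) * inverse c"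
        using c by (simp add: field_simps)
      then have "?\<Lambda> p = Re (c * ?\<Lambda> p) *\<^sub>R inverse c"
        by (simp only: scaleR_conv_of_real)
      then show ?thesis
        by (metis span_mul span_base singletonI)
    qed
    then have "dim (range ?\<Lambda>) \<le> card {inverse c}"
      by (intro dim_le_card) auto
    then show ?thesis
      by (simp add: lin_rank_def)
  qed
  have rank_1: "lin_rank ?\<Lambda> \<noteq> 1" if "l \<noteq> 0"
  proof -
    \<comment> \<open>At the quaternions that represent its real and its imaginary part as linear forms, \<open>c \<Lambda>\<close>
      takes a non-zero real and a non-zero imaginary value, since these parts are orthogonal.\<close>
    define w where "w = of_real (2 * N) / c"
    have "w \<noteq> 0"
      using c \<open>N \<noteq> 0\<close> by (simp add: w_def)
    have "c * ?\<Lambda> (emb i (- cnj y) + emb i (cnj x) * j) = of_real (2 * N)"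
      unfolding form eqs of_real_mult N cnjs unfolding \<xi>_def \<eta>_def complex_cnj_minus complex_cnj_cnj of_real_numeral
      by algebra
    then have "?\<Lambda> (emb i (- cnj y) + emb i (cnj x) * j) = w"
      using c by (simp add: w_def field_simps)
    then have w: "w \<in> range ?\<Lambda>" by (metis rangeI)
    have "c * ?\<Lambda> (emb i (- cnj \<eta>) + emb i (cnj \<xi>) * j) = of_real (2 * N) * L"
      unfolding form eqs of_real_mult N complex_cnj_minus complex_cnj_cnj of_real_numeral
      unfolding cnjs unfolding \<xi>_def \<eta>_def using st' by algebra
    then have "?\<Lambda> (emb i (- cnj \<eta>) + emb i (cnj \<xi>) * j) = w * L"
      using c by (simp add: w_def field_simps)
    then have wL: "w * L \<in> range ?\<Lambda>" by (metis rangeI)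
    have "w * L \<notin> span {w}"
    proof
      assume "w * L \<in> span {w}"
      then obtain r where "w * L = r *\<^sub>R w"
        by (auto simp: span_singleton)
      then have "L = of_real r"
        using \<open>w \<noteq> 0\<close> by (simp add: scaleR_conv_of_real mult.commute)
      then show False
        using that by (simp add: L_def complex_eq_iff)
    qed
    then have "independent {w * L, w}" and "w * L \<noteq> w"
      using \<open>w \<noteq> 0\<close> by (auto simp: independent_insert span_base)
    then have "2 \<le> dim (range ?\<Lambda>)"
      using independent_card_le_dim[of "{w * L, w}" "range ?\<Lambda>"] w wL by simp
    then show ?thesis
      by (simp add: lin_rank_def)
  qed
  show ?thesis
    using l orbit disc_iff rank_0 rank_1 by blast
qed

end

lemma A_minus_eq: "A_minus = kappa ` PGL2H_orbit (pt (normal_point 0))"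
proof -
  have "normal_point 0 = (- 1) *s vector [1, 0, 0, 0, 0, - 1]"
    by (rule vec6_eqI) (simp_all add: normal_point_def)
  then have "pt (vector [1, 0, 0, 0, 0, - 1]) = pt (normal_point 0)"
    unfolding pt_eq_iff by (intro exI[of _ "- 1"]) simp
  then show ?thesis
    by (simp add: A_minus_def)
qed

lemma A_QN_eq: "A_QN = kappa ` PGL2H_orbit (pt (normal_point 1))"
  by (simp add: A_QN_def normal_point_def)

lemma normal_point_in_A_nd:
  "0 < l \<Longrightarrow> l < 1 \<Longrightarrow> kappa ` PGL2H_orbit (pt (normal_point l)) \<subseteq> A_nd"
  unfolding A_nd_def normal_point_def by (intro image_mono UN_upper) simp

section \<open>Planar slice-regular polynomials\<close>

theorem theorem4p6:
  fixes i j :: quat and \<Omega> S :: "quat set" and f :: "quat \<Rightarrow> quat"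
    and n r :: nat and a :: "nat \<Rightarrow> quat" and Af :: "(quat \<Rightarrow> complex) set"
  assumes "i \<in> imag_units" and "j \<in> imag_units" and "i * j = - (j * i)"
    and "symmetric_slice_domain \<Omega>"
    and "\<forall>q\<in>\<Omega>. f q = (\<Sum>m\<le>n. q ^ m * a m)"
    and "\<not> f constant_on \<Omega>"
    and "planar i j \<Omega> f"
    and "S = span (a ` {1..n})" and "r = dim S"
    and "Af = {\<Lambda>. linear \<Lambda> \<and> (\<forall>s\<in>S. \<Lambda> s = 0)}"
  shows "r \<le> 3 \<and>
    module.subspace fscale Af \<and>
    (\<exists>\<phi>. Vector_Spaces.linear fscale fscale \<phi> \<and>
             bij_betw (\<lambda>P. \<phi> ` P) (CP (3 - r)) (projectivization fscale Af)) \<and>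
    bij_betw (\<lambda>P. the_elem ((\<lambda>\<Lambda>. hyperplane_section (lin_vec i j (a 0) \<Lambda>)) ` P))
           (projectivization fscale Af)
           {hyperplane_section z |z. z \<noteq> 0 \<and> twistor i j f ` upper_part i \<Omega> \<subseteq> hyperplane_section z} \<and>
    (\<forall>\<Lambda>\<in>Af. \<Lambda> \<noteq> 0 \<longrightarrow> lin_vec i j (a 0) \<Lambda> \<noteq> 0 \<and>
           twistor i j f ` upper_part i \<Omega> \<subseteq> hyperplane_section (lin_vec i j (a 0) \<Lambda>)) \<and>
    (\<forall>z. z \<noteq> 0 \<and> twistor i j f ` upper_part i \<Omega> \<subseteq> hyperplane_section z \<longrightarrow>
           (\<exists>\<Lambda>\<in>Af. \<Lambda> \<noteq> 0 \<and> pt z = pt (lin_vec i j (a 0) \<Lambda>) \<and>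
                    hyperplane_section z = hyperplane_section (lin_vec i j (a 0) \<Lambda>))) \<and>
    (\<forall>\<Lambda>\<in>Af. \<forall>\<Lambda>'\<in>Af. \<Lambda> \<noteq> 0 \<and> \<Lambda>' \<noteq> 0 \<longrightarrow>
           (hyperplane_section (lin_vec i j (a 0) \<Lambda>) = hyperplane_section (lin_vec i j (a 0) \<Lambda>')
              \<longleftrightarrow> (\<exists>c. c \<noteq> 0 \<and> \<Lambda>' = fscale c \<Lambda>))) \<and>
    (\<forall>\<Lambda>\<in>Af. \<Lambda> \<noteq> 0 \<longrightarrow> lin_rank \<Lambda> = 1 \<longrightarrow>
           pt (lin_vec i j (a 0) \<Lambda>) \<in> A_minus \<and> A_planar A_minus i j \<Omega> f) \<and>
    (\<forall>\<Lambda>\<in>Af. \<Lambda> \<noteq> 0 \<longrightarrow> lin_rank \<Lambda> = 2 \<longrightarrow> lin_disc i j \<Lambda> = 0 \<longrightarrow>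
           pt (lin_vec i j (a 0) \<Lambda>) \<in> A_QN \<and> A_planar A_QN i j \<Omega> f) \<and>
    (\<forall>\<Lambda>\<in>Af. \<Lambda> \<noteq> 0 \<longrightarrow> lin_rank \<Lambda> = 2 \<longrightarrow> lin_disc i j \<Lambda> \<noteq> 0 \<longrightarrow>
           pt (lin_vec i j (a 0) \<Lambda>) \<in> A_nd \<and> A_planar A_nd i j \<Omega> f)"
proof -
  note ij = \<open>i \<in> imag_units\<close> \<open>j \<in> imag_units\<close> \<open>i * j = - (j * i)\<close>
  let ?vec = "lin_vec i j (a 0)" and ?contains = "\<lambda>z. twistor i j f ` upper_part i \<Omega> \<subseteq> hyperplane_section z"
  interpret F: vector_space "fscale :: complex \<Rightarrow> (quat \<Rightarrow> complex) \<Rightarrow> _"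
    by (rule vector_space_fscale)
  have S: "subspace S"
    by (simp add: assms(8))
  have Af_iff: "\<Lambda> \<in> Af \<longleftrightarrow> linear \<Lambda> \<and> (\<forall>m\<in>{1..n}. \<Lambda> (a m) = 0)" for \<Lambda>
    unfolding assms(8,10) using linear_eq_0_on_span[of \<Lambda> "a ` {1..n}"]
    by (auto intro: span_base)
  have sub: "F.subspace Af"
    unfolding assms(10) by (rule subspace_annihilator)
  have contains_iff: "?contains z \<longleftrightarrow>
      z$1 = 0 \<and> z$6 = - coord_form i j z (a 0) \<and> (\<forall>m\<in>{1..n}. coord_form i j z (a m) = 0)" for z
    by (rule twistor_curve_in_section_iff[OF ij assms(4-6)])

  have form: "coord_form i j (?vec \<Lambda>) = \<Lambda>" if "\<Lambda> \<in> Af" for \<Lambda>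
    using that Af_iff coord_form_lin_vec[OF ij] by blast
  have form_0: "coord_form i j 0 = 0"
    by (simp add: coord_form_def fun_eq_iff)
  have vec_0: "?vec \<Lambda> \<noteq> 0" if "\<Lambda> \<in> Af" "\<Lambda> \<noteq> 0" for \<Lambda>
    using form[OF that(1)] form_0 that(2) by metis
  have vec_contains: "?contains (?vec \<Lambda>)" if "\<Lambda> \<in> Af" for \<Lambda>
    using that by (simp add: contains_iff form lin_vec_nth[OF ij] Af_iff)
  have contains_vec: "coord_form i j z \<in> Af \<and> coord_form i j z \<noteq> 0 \<and> z = ?vec (coord_form i j z)"
    if "z \<noteq> 0" "?contains z" for z
  proof -
    have z: "z$1 = 0" "z$6 = - coord_form i j z (a 0)" "coord_form i j z \<in> Af"
      using that(2) linear_coord_form[OF ij] by (simp_all add: contains_iff Af_iff)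
    have vec: "?vec (coord_form i j z) = z"
      by (rule lin_vec_coord_form[OF ij z(1,2)])
    moreover have "coord_form i j z \<noteq> 0"
    proof
      assume 0: "coord_form i j z = 0"
      have "?vec 0 = 0"
        using lin_vec_fscale[OF ij, of 0 "a 0" 0] linear_zero
        by (simp add: zero_fun_def fscale_def)
      with 0 vec \<open>z \<noteq> 0\<close> show False by simp
    qed
    ultimately show ?thesis
      using z(3) by simp
  qed
  have linear_part: "(?vec \<Lambda> $ 2, ?vec \<Lambda> $ 3, ?vec \<Lambda> $ 4, ?vec \<Lambda> $ 5) \<noteq> (0, 0, 0, 0)"
    if "\<Lambda> \<in> Af" "\<Lambda> \<noteq> 0" for \<Lambda>
  proof
    assume "(?vec \<Lambda> $ 2, ?vec \<Lambda> $ 3, ?vec \<Lambda> $ 4, ?vec \<Lambda> $ 5) = (0, 0, 0, 0)"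
    then have "coord_form i j (?vec \<Lambda>) = 0"
      by (simp add: coord_form_def fun_eq_iff)
    with form that show False by simp
  qed
  have section_inj: "\<exists>c. c \<noteq> 0 \<and> \<Lambda>' = fscale c \<Lambda>"
    if \<Lambda>: "\<Lambda> \<in> Af" "\<Lambda> \<noteq> 0" and \<Lambda>': "\<Lambda>' \<in> Af" "\<Lambda>' \<noteq> 0"
      and eq: "hyperplane_section (?vec \<Lambda>) = hyperplane_section (?vec \<Lambda>')" for \<Lambda> \<Lambda>'
  proof -
    obtain c where "c \<noteq> 0" and "?vec \<Lambda>' = c *s ?vec \<Lambda>"
      using hyperplane_section_eq_imp[OF lin_vec_nth(1)[OF ij] linear_part[OF \<Lambda>]
          lin_vec_nth(1)[OF ij] linear_part[OF \<Lambda>'] eq] by blast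
    then have "coord_form i j (?vec \<Lambda>') = fscale c (coord_form i j (?vec \<Lambda>))"
      by (simp add: coord_form_smult[OF ij])
    with \<open>c \<noteq> 0\<close> show ?thesis
      using form \<Lambda> \<Lambda>' by auto
  qed
  have section_scale: "hyperplane_section (?vec (fscale c \<Lambda>)) = hyperplane_section (?vec \<Lambda>)"
    if "\<Lambda> \<in> Af" "c \<noteq> 0" for c \<Lambda>
    using that by (simp add: lin_vec_fscale[OF ij] Af_iff hyperplane_section_smult)

  have "r \<le> 3"
  proof -
    obtain z where "z \<noteq> 0" "?contains z"
      using assms(7) by (auto simp: planar_def)
    then have \<Lambda>: "coord_form i j z \<in> Af" "coord_form i j z \<noteq> 0"
      using contains_vec by blast+
    have "S \<noteq> UNIV"
      using \<Lambda> unfolding assms(10) by (auto simp: fun_eq_iff)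
    then have "dim S \<noteq> DIM(quat)"
      using S dim_eq_full[of S] by (simp add: span_eq_iff[THEN iffD2])
    moreover have "dim S \<le> DIM(quat)"
      by (rule dim_subset_UNIV)
    ultimately show ?thesis
      by (simp add: assms(9))
  qed
  then obtain \<phi> where \<phi>: "Vector_Spaces.linear fscale fscale \<phi>" "bij_betw \<phi> {u. \<forall>k>3 - r. u k = 0} Af"
    using annihilator_parametrization[OF S, of "3 - r"] unfolding assms(9,10) by auto
  have P_bij: "bij_betw (\<lambda>P. \<phi> ` P) (CP (3 - r)) (projectivization fscale Af)"
    unfolding CP_def by (rule bij_betw_projectivization[OF \<phi>(1) subspace_supported \<phi>(2)])

  have sections: "(\<lambda>\<Lambda>. hyperplane_section (?vec \<Lambda>)) ` (Af - {0})
      = {hyperplane_section z |z. z \<noteq> 0 \<and> ?contains z}"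
  proof
    show "(\<lambda>\<Lambda>. hyperplane_section (?vec \<Lambda>)) ` (Af - {0}) \<subseteq> {hyperplane_section z |z. z \<noteq> 0 \<and> ?contains z}"
      using vec_0 vec_contains by blast
    show "{hyperplane_section z |z. z \<noteq> 0 \<and> ?contains z} \<subseteq> (\<lambda>\<Lambda>. hyperplane_section (?vec \<Lambda>)) ` (Af - {0})"
    proof
      fix X assume "X \<in> {hyperplane_section z |z. z \<noteq> 0 \<and> ?contains z}"
      then obtain z where z: "X = hyperplane_section z" "z \<noteq> 0" "?contains z"
        by blast
      from contains_vec[OF z(2,3)] have "coord_form i j z \<in> Af - {0}"
        "X = hyperplane_section (?vec (coord_form i j z))"
        using z(1) by auto
      then show "X \<in> (\<lambda>\<Lambda>. hyperplane_section (?vec \<Lambda>)) ` (Af - {0})"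
        by blast
    qed
  qed
  have section_bij: "bij_betw (\<lambda>P. the_elem ((\<lambda>\<Lambda>. hyperplane_section (?vec \<Lambda>)) ` P))
      (projectivization fscale Af) {hyperplane_section z |z. z \<noteq> 0 \<and> ?contains z}"
    unfolding sections[symmetric]
    by (rule bij_betw_projectivization_induced[OF vector_space_fscale])
      (use section_inj section_scale in blast)+

  have type: "\<exists>l. 0 \<le> l \<and> l \<le> 1 \<and> pt (?vec \<Lambda>) \<in> kappa ` PGL2H_orbit (pt (normal_point l)) \<and>
      (lin_rank \<Lambda> = 1 \<longrightarrow> l = 0) \<and> (lin_rank \<Lambda> = 2 \<longrightarrow> l \<noteq> 0) \<and> (lin_disc i j \<Lambda> = 0 \<longleftrightarrow> l = 1)"
    if "\<Lambda> \<in> Af" "\<Lambda> \<noteq> 0" for \<Lambda>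
    using coord_form_orbit[OF ij, of "?vec \<Lambda>" "a 0"] that
    by (simp add: form lin_vec_nth[OF ij] lin_disc_eq[OF ij refl, of \<Lambda> "a 0"])
  have A_planarI: "A_planar A i j \<Omega> f" if "\<Lambda> \<in> Af" "\<Lambda> \<noteq> 0" "pt (?vec \<Lambda>) \<in> A" for A \<Lambda>
    unfolding A_planar_def using that vec_0 vec_contains by blast
  have rank_1: "pt (?vec \<Lambda>) \<in> A_minus" if \<Lambda>: "\<Lambda> \<in> Af" "\<Lambda> \<noteq> 0" "lin_rank \<Lambda> = 1" for \<Lambda>
  proof -
    obtain l where "pt (?vec \<Lambda>) \<in> kappa ` PGL2H_orbit (pt (normal_point l))" "l = 0"
      using type[OF \<Lambda>(1,2)] \<Lambda>(3) by auto
    then show ?thesis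
      by (simp only: A_minus_eq)
  qed
  have rank_2: "pt (?vec \<Lambda>) \<in> A_QN" if \<Lambda>: "\<Lambda> \<in> Af" "\<Lambda> \<noteq> 0" "lin_disc i j \<Lambda> = 0" for \<Lambda>
  proof -
    obtain l where "pt (?vec \<Lambda>) \<in> kappa ` PGL2H_orbit (pt (normal_point l))" "l = 1"
      using type[OF \<Lambda>(1,2)] \<Lambda>(3) by auto
    then show ?thesis
      by (simp only: A_QN_eq)
  qed
  have rank_2': "pt (?vec \<Lambda>) \<in> A_nd"
    if \<Lambda>: "\<Lambda> \<in> Af" "\<Lambda> \<noteq> 0" "lin_rank \<Lambda> = 2" "lin_disc i j \<Lambda> \<noteq> 0" for \<Lambda>
  proof -
    obtain l where "0 \<le> l" "l \<le> 1" "l \<noteq> 0" "l \<noteq> 1"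
      and l: "pt (?vec \<Lambda>) \<in> kappa ` PGL2H_orbit (pt (normal_point l))"
      using type[OF \<Lambda>(1,2)] \<Lambda>(3,4) by blast
    then have "0 < l" "l < 1"
      by simp_all
    with l show ?thesis
      using normal_point_in_A_nd by blast
  qed
  show ?thesis
  proof (intro conjI)
    show "\<exists>\<phi>. Vector_Spaces.linear fscale fscale \<phi> \<and>
        bij_betw (\<lambda>P. \<phi> ` P) (CP (3 - r)) (projectivization fscale Af)"
      using \<phi>(1) P_bij by blast
    show "\<forall>z. z \<noteq> 0 \<and> ?contains z \<longrightarrow> (\<exists>\<Lambda>\<in>Af. \<Lambda> \<noteq> 0 \<and> pt z = pt (?vec \<Lambda>) \<and>
        hyperplane_section z = hyperplane_section (?vec \<Lambda>))"
      using contains_vec by metis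
    show "\<forall>\<Lambda>\<in>Af. \<forall>\<Lambda>'\<in>Af. \<Lambda> \<noteq> 0 \<and> \<Lambda>' \<noteq> 0 \<longrightarrow>
        (hyperplane_section (?vec \<Lambda>) = hyperplane_section (?vec \<Lambda>')
          \<longleftrightarrow> (\<exists>c. c \<noteq> 0 \<and> \<Lambda>' = fscale c \<Lambda>))"
      using section_inj section_scale by blast
    show "\<forall>\<Lambda>\<in>Af. \<Lambda> \<noteq> 0 \<longrightarrow> ?vec \<Lambda> \<noteq> 0 \<and> ?contains (?vec \<Lambda>)"
      using vec_0 vec_contains by simp
  qed (use rank_1 rank_2 rank_2' A_planarI in \<open>simp_all add: \<open>r \<le> 3\<close> sub section_bij\<close>)
qed

end
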